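(* For every non-vacuum single-mode Gaussian pure state $|\psi\rangle=D(\alpha)S(\zeta)|0\rangle$, $(\alpha,\zeta)\in\mathbb C^2$, $(\alpha,\zeta)\ne(0,0)$, and every $\Delta>0$, the shell-probability vectors satisfy $$\boldsymbol P_\psi(\Delta)\prec\boldsymbol P_0(\Delta)\qquad\text{and}\qquad \boldsymbol P_0(\Delta)\nprec\boldsymbol P_\psi(\Delta).$$
   Context: Units $\hbar=1$. On $L^2(\mathbb R)$ with $\hat a=(\hat q+i\hat p)/\sqrt2$ and oscillator vacuum $|0\rangle$, $D(\alpha)=\exp(\alpha\hat a^\dagger-\alpha^*\hat a)$ is the displacement operator and $S(\zeta)=\exp[\tfrac12(\zeta^*\hat a^2-\zeta\hat a^{\dagger2})]$ the squeezing operator. The Wigner function of a state $\rho$ is $W_\rho(q,p)=\frac1\pi\int_{-\infty}^\infty e^{2ipy}\langle q-y|\rho|q+y\rangle\,dy$; $W_\psi$ denotes that of $|\psi\rangle\langle\psi|$. Equal-area shells: $A_k(\Delta)=\{\boldsymbol r\in\mathbb R^2:(k-1)\Delta\le|\boldsymbol r|^2<k\Delta\}$, $k\ge1$, and $P_{\psi,k}(\Delta)=\int_{A_k(\Delta)}W_\psi(\boldsymbol r)\,d\boldsymbol r$, $\boldsymbol P_\psi(\Delta)=(P_{\psi,k}(\Delta))_{k\ge1}$. For the vacuum, $\boldsymbol P_0(\Delta)=(1-e^{-\Delta})(1,e^{-\Delta},e^{-2\Delta},\ldots)$. Majorization: for (infinite) probability vectors, $\boldsymbol x\prec\boldsymbol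 y$ means $\sum_{j=1}^m x_j^\downarrow\le\sum_{j=1}^m y_j^\downarrow$ for all $m\ge1$ (non-increasing rearrangements), with equal total sums. *)

theory Defs
  imports "HOL-Analysis.Analysis"
begin

section \<open>Square-integrable wave functions\<close>

text \<open>Elements of \<open>L\<^sup>2(\<real>)\<close> are represented by Borel functions; two functions that agree almost
  everywhere represent the same vector.\<close>

type_synonym wavefun = "real \<Rightarrow> complex"

definition L2 :: "wavefun set" where
  "L2 = {f. f \<in> borel_measurable lborel \<and> integrable lborel (\<lambda>x. (cmod (f x))\<^sup>2)}"

definition l2norm :: "wavefun \<Rightarrow> real" where
  "l2norm f = sqrt (LINT x|lborel. (cmod (f x))\<^sup>2)"

definition schwartz :: "wavefun set" where
  "schwartz = {f. \<forall>k.
     (\<forall>x. ((\<lambda>g y. vector_derivative g (at y)) ^^ k) f differentiable at x) \<and>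
     (\<forall>m. bounded (range (\<lambda>x. complex_of_real (x ^ m) *
        ((\<lambda>g y. vector_derivative g (at y)) ^^ k) f x)))}"


section \<open>Unbounded operators and their exponentials\<close>

text \<open>Operators are given by their graphs.\<close>

type_synonym opgraph = "(wavefun \<times> wavefun) set"

definition l2_closure :: "opgraph \<Rightarrow> opgraph" where
  "l2_closure G = {(f, g). f \<in> L2 \<and> g \<in> L2 \<and>
     (\<forall>\<epsilon>>0. \<exists>f' g'. (f', g') \<in> G \<and> f' \<in> L2 \<and> g' \<in> L2 \<and>
        l2norm (\<lambda>x. f x - f' x) < \<epsilon> \<and> l2norm (\<lambda>x. g x - g' x) < \<epsilon>)}"

text \<open>Time-one map of the strong solutions of \<open>u' = G u\<close>, the derivative being taken in the
  \<open>L\<^sup>2\<close> norm.\<close>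

definition flow_graph :: "opgraph \<Rightarrow> opgraph" where
  "flow_graph G = {(f, g). \<exists>u v. u (0::real) = f \<and> u 1 = g \<and>
     (\<forall>t. (u t, v t) \<in> G \<and>
        ((\<lambda>h. l2norm (\<lambda>x. (u (t + h) x - u t x) / complex_of_real h - v t x)) \<longlongrightarrow> 0) (at 0))}"

text \<open>The exponential of an essentially skew-adjoint operator \<open>A\<close> in the sense of Stone's theorem.
  For \<open>f\<close> in the domain of the closure \<open>B\<close> of \<open>A\<close>, the curve \<open>t \<mapsto> exp (t B) f\<close> is the unique
  strong solution of \<open>u' = B u\<close>, \<open>u 0 = f\<close>; the resulting isometry is then extended to \<open>L\<^sup>2(\<real>)\<close>
  by taking the closure of its graph. (The power series of the exponential is not
  available: already for the squeezing generator it diverges on the vacuum for large \<open>\<zeta>\<close>.)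
  The value is determined up to equality almost everywhere.\<close>

definition exp_op :: "opgraph \<Rightarrow> wavefun \<Rightarrow> wavefun" where
  "exp_op A f = (SOME g. (f, g) \<in> l2_closure (flow_graph (l2_closure A)))"


section \<open>Gaussian pure states\<close>

definition position_op :: "wavefun \<Rightarrow> wavefun" where
  "position_op f = (\<lambda>x. complex_of_real x * f x)"

definition momentum_op :: "wavefun \<Rightarrow> wavefun" where
  "momentum_op f = (\<lambda>x. - \<i> * vector_derivative f (at x))"

definition annihilation :: "wavefun \<Rightarrow> wavefun" where
  "annihilation f = (\<lambda>x. (position_op f x + \<i> * momentum_op f x) / complex_of_real (sqrt 2))"

definition creation :: "wavefun \<Rightarrow> wavefun" where
  "creation f = (\<lambda>x. (position_op f x - \<i> * momentum_op f x) / complex_of_real (sqrt 2))"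

text \<open>Both generators are essentially skew-adjoint on the Schwartz space.\<close>

definition displacement :: "complex \<Rightarrow> wavefun \<Rightarrow> wavefun" where
  "displacement \<alpha> = exp_op {(f, g). f \<in> schwartz \<and>
     g = (\<lambda>x. \<alpha> * creation f x - cnj \<alpha> * annihilation f x)}"

definition squeezing :: "complex \<Rightarrow> wavefun \<Rightarrow> wavefun" where
  "squeezing \<zeta> = exp_op {(f, g). f \<in> schwartz \<and>
     g = (\<lambda>x. (cnj \<zeta> * annihilation (annihilation f) x - \<zeta> * creation (creation f) x) / 2)}"

definition vacuum :: wavefun where
  "vacuum = (\<lambda>x. complex_of_real (pi powr (- 1 / 4) * exp (- x\<^sup>2 / 2)))"

lemma annihilation_vacuum: "annihilation vacuum = (\<lambda>x. 0)"
proof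
  fix x :: real
  have "((\<lambda>x. pi powr (- 1 / 4) * exp (- x\<^sup>2 / 2)) has_real_derivative
      - x * (pi powr (- 1 / 4) * exp (- x\<^sup>2 / 2))) (at x)"
    by (auto intro!: derivative_eq_intros)
  then have "(vacuum has_vector_derivative
      complex_of_real (- x * (pi powr (- 1 / 4) * exp (- x\<^sup>2 / 2)))) (at x)"
    unfolding vacuum_def
    by (intro has_vector_derivative_of_real)
       (simp add: has_real_derivative_iff_has_vector_derivative)
  then have "vector_derivative vacuum (at x) = - complex_of_real x * vacuum x"
    by (simp add: vector_derivative_at vacuum_def)
  then show "annihilation vacuum x = 0"
    by (simp add: annihilation_def position_op_def momentum_op_def flip: mult.assoc)
qed


section \<open>Wigner functions and shell probabilities\<close>

text \<open>For \<open>\<rho> = |\<psi>\<rangle>\<langle>\<psi>|\<close> the kernel \<open>\<langle>q - y|\<rho>|q + y\<rangle>\<close> is \<open>\<psi>(q - y) \<psi>(q + y)\<^sup>*\<close>. The integral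
  is real, since \<open>y \<mapsto> - y\<close> conjugates the integrand; the real part only fixes the type.\<close>

definition wigner :: "wavefun \<Rightarrow> real \<times> real \<Rightarrow> real" where
  "wigner \<psi> = (\<lambda>(q, p). Re (1 / complex_of_real pi *
     (LINT y|lborel. exp (2 * \<i> * complex_of_real (p * y)) * (\<psi> (q - y) * cnj (\<psi> (q + y))))))"

definition shell :: "real \<Rightarrow> nat \<Rightarrow> (real \<times> real) set" where
  "shell \<Delta> k = {r. (real k - 1) * \<Delta> \<le> (norm r)\<^sup>2 \<and> (norm r)\<^sup>2 < real k * \<Delta>}"

text \<open>Shells are numbered from 1, whereas sequences start at index 0.\<close>

definition shell_probs :: "wavefun \<Rightarrow> real \<Rightarrow> nat \<Rightarrow> real" where
  "shell_probs \<psi> \<Delta> = (\<lambda>j. LINT r:shell \<Delta> (Suc j)|lborel. wigner \<psi> r)"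


section \<open>Majorization\<close>

text \<open>For a nonnegative sequence \<open>x\<close> tending to 0. Only the nonzero entries are matched: a sequence
  with infinitely many positive entries and some zero entries has no non-increasing
  rearrangement by a permutation of the indices, and its zeros are dropped.\<close>

definition is_decr_rearrangement :: "(nat \<Rightarrow> real) \<Rightarrow> (nat \<Rightarrow> real) \<Rightarrow> bool" where
  "is_decr_rearrangement x y \<longleftrightarrow> antimono y \<and>
     (\<exists>\<pi>. bij_betw \<pi> {j. y j \<noteq> 0} {j. x j \<noteq> 0} \<and> (\<forall>j. y j \<noteq> 0 \<longrightarrow> y j = x (\<pi> j)))"

definition decr_rearrangement :: "(nat \<Rightarrow> real) \<Rightarrow> nat \<Rightarrow> real" where
  "decr_rearrangement x = (THE y. is_decr_rearrangement x y)"

definition majorized_by :: "(nat \<Rightarrow> real) \<Rightarrow> (nat \<Rightarrow> real) \<Rightarrow> bool" (infix "\<preceq>\<^sub>m" 50) where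
  "x \<preceq>\<^sub>m y \<longleftrightarrow>
     (\<forall>m. (\<Sum>j<m. decr_rearrangement x j) \<le> (\<Sum>j<m. decr_rearrangement y j)) \<and>
     (\<exists>s. x sums s \<and> y sums s)"

end

theory Submission
  imports Defs "HOL-Probability.Probability"
begin

text \<open>The squeezing and displacement generators are skew-symmetric on the Schwartz space, so strong
  solutions of \<open>u' = A u\<close> are unique up to null sets, and the explicit Gaussian solutions identify
  \<open>D(\<alpha>)S(\<zeta>)|0\<rangle>\<close>. Its Wigner function is that of the vacuum composed with an area-preserving affine
  map. Every union \<open>U\<close> of \<open>m\<close> shells has area \<open>m \<pi> \<Delta>\<close>, and integrating \<open>W - c\<close> over \<open>U\<close> gives
  \<open>\<integral>\<^sub>U W \<le> \<integral> max 0 (W - c) + c |U|\<close>. The right-hand side does not see the affine map, and for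
  \<open>c = exp (- m \<Delta>) / \<pi>\<close> it is attained by the vacuum on the disc of area \<open>m \<pi> \<Delta>\<close>. For \<open>m = 1\<close> the
  inequality is strict for every non-vacuum state, since no shell lies in the ellipse \<open>W \<ge> c\<close>.\<close>

section \<open>The semi-inner product on square-integrable functions\<close>

text \<open>\<open>exp_op\<close> picks its value by \<open>SOME\<close> from a closed graph, so
  nothing is known about a squeezed or displaced state until one solution is exhibited. An explicit
  solution settles this twice over: the choice is from a non-empty set, and the isometry of the flow
  forces all candidates to agree almost everywhere. Since the output of \<open>squeezing\<close> is
  the input of \<open>displacement\<close>, the identification has to accept inputs known only up to
  a null set, and \<open>wigner\<close> has to be shown blind to null sets.

  The generators are at most quadratic in x and d/dx, so they preserve the ansatz exp (- w x^2 / 2 +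
  b x + c), and the evolution becomes a system of ordinary differential equations for (w, b, c).
  With w = a + i s, the exponent of the Wigner function is minus a quadratic form of determinant 1
  about the centre of the state; this is where preservation of area comes from. The level exp (- m
  \<Delta>) / \<pi> is the value of the vacuum's Wigner function on the circle around m shells, so
  the disc inside is exactly the region where the vacuum exceeds that level.\<close>

definition l2inner :: "wavefun \<Rightarrow> wavefun \<Rightarrow> complex" where
  "l2inner f g = (LINT x|lborel. cnj (f x) * g x)"

lemma L2_measurable [measurable_dest]: "f \<in> L2 \<Longrightarrow> f \<in> borel_measurable borel"
  by (simp add: L2_def)

lemma L2_integrable_norm_sq: "f \<in> L2 \<Longrightarrow> integrable lborel (\<lambda>x. (cmod (f x))\<^sup>2)"
  by (simp add: L2_def)

lemma l2norm_nonneg [simp]: "0 \<le> l2norm f"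
  by (simp add: l2norm_def)

lemma l2norm_sq: "(l2norm f)\<^sup>2 = (LINT x|lborel. (cmod (f x))\<^sup>2)"
  by (simp add: l2norm_def)

lemma L2_bound:
  assumes "g \<in> borel_measurable borel" and "integrable lborel h"
    and "\<And>x. (cmod (g x))\<^sup>2 \<le> h x"
  shows "g \<in> L2"
  unfolding L2_def
proof (intro CollectI conjI)
  show "g \<in> borel_measurable lborel" using assms(1) by simp
  have [measurable]: "g \<in> borel_measurable borel" by fact
  show "integrable lborel (\<lambda>x. (cmod (g x))\<^sup>2)"
    by (rule Bochner_Integration.integrable_bound[OF assms(2)])
       (auto intro!: AE_I2 order_trans[OF assms(3)])
qed

lemma cmod_add_sq_le: "(cmod (a + b))\<^sup>2 \<le> 2 * (cmod a)\<^sup>2 + 2 * (cmod b)\<^sup>2"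
proof -
  have "(cmod (a + b))\<^sup>2 \<le> (cmod a + cmod b)\<^sup>2"
    by (intro power_mono norm_triangle_ineq) auto
  also have "\<dots> \<le> 2 * (cmod a)\<^sup>2 + 2 * (cmod b)\<^sup>2"
    using sum_squares_bound[of "cmod a" "cmod b"] by (simp add: power2_sum)
  finally show ?thesis .
qed

lemma L2_add:
  assumes "f \<in> L2" "g \<in> L2"
  shows "(\<lambda>x. f x + g x) \<in> L2"
proof (rule L2_bound)
  have [measurable]: "f \<in> borel_measurable borel" "g \<in> borel_measurable borel"
    using assms by (auto dest: L2_measurable)
  show "(\<lambda>x. f x + g x) \<in> borel_measurable borel" by measurable
  show "integrable lborel (\<lambda>x. 2 * (cmod (f x))\<^sup>2 + 2 * (cmod (g x))\<^sup>2)"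
    using assms by (auto dest!: L2_integrable_norm_sq)
qed (rule cmod_add_sq_le)

lemma L2_cmult:
  assumes "f \<in> L2"
  shows "(\<lambda>x. c * f x) \<in> L2"
proof (rule L2_bound)
  have [measurable]: "f \<in> borel_measurable borel"
    using assms by (auto dest: L2_measurable)
  show "(\<lambda>x. c * f x) \<in> borel_measurable borel" by measurable
  show "integrable lborel (\<lambda>x. (cmod c)\<^sup>2 * (cmod (f x))\<^sup>2)"
    using assms by (auto dest!: L2_integrable_norm_sq)
qed (simp add: norm_mult power_mult_distrib)

lemma L2_diff: "f \<in> L2 \<Longrightarrow> g \<in> L2 \<Longrightarrow> (\<lambda>x. f x - g x) \<in> L2"
  using L2_add[of f "\<lambda>x. - 1 * g x"] L2_cmult[of g "- 1"] by simp

lemma integrable_l2inner: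
  assumes "f \<in> L2" "g \<in> L2"
  shows "integrable lborel (\<lambda>x. cnj (f x) * g x)"
proof (rule Bochner_Integration.integrable_bound)
  have [measurable]: "f \<in> borel_measurable borel" "g \<in> borel_measurable borel"
    using assms by (auto dest: L2_measurable)
  have "cnj \<in> borel_measurable borel"
    by (intro borel_measurable_continuous_onI continuous_intros)
  then show "(\<lambda>x. cnj (f x) * g x) \<in> borel_measurable lborel" by measurable
  show "integrable lborel (\<lambda>x. (cmod (f x))\<^sup>2 + (cmod (g x))\<^sup>2)"
    using assms by (auto dest!: L2_integrable_norm_sq)
  show "AE x in lborel. norm (cnj (f x) * g x) \<le> norm ((cmod (f x))\<^sup>2 + (cmod (g x))\<^sup>2)"
  proof (rule AE_I2)
    fix x
    have "cmod (f x) * cmod (g x) \<le> 2 * cmod (f x) * cmod (g x)" by simp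
    then have "cmod (f x) * cmod (g x) \<le> (cmod (f x))\<^sup>2 + (cmod (g x))\<^sup>2"
      using sum_squares_bound[of "cmod (f x)" "cmod (g x)"] by linarith
    then show "norm (cnj (f x) * g x) \<le> norm ((cmod (f x))\<^sup>2 + (cmod (g x))\<^sup>2)"
      by (simp add: norm_mult)
  qed
qed

lemma l2inner_add_right:
  "f \<in> L2 \<Longrightarrow> g \<in> L2 \<Longrightarrow> h \<in> L2 \<Longrightarrow> l2inner f (\<lambda>x. g x + h x) = l2inner f g + l2inner f h"
  by (simp add: l2inner_def distrib_left integrable_l2inner)

lemma l2inner_diff_right:
  "f \<in> L2 \<Longrightarrow> g \<in> L2 \<Longrightarrow> h \<in> L2 \<Longrightarrow> l2inner f (\<lambda>x. g x - h x) = l2inner f g - l2inner f h"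
  by (simp add: l2inner_def right_diff_distrib integrable_l2inner)

lemma l2inner_diff_left:
  "f \<in> L2 \<Longrightarrow> g \<in> L2 \<Longrightarrow> h \<in> L2 \<Longrightarrow> l2inner (\<lambda>x. f x - g x) h = l2inner f h - l2inner g h"
  by (simp add: l2inner_def left_diff_distrib integrable_l2inner)

lemma l2inner_cmult_right: "l2inner f (\<lambda>x. c * g x) = c * l2inner f g"
  by (simp add: l2inner_def algebra_simps)

lemma cnj_l2inner: "cnj (l2inner f g) = l2inner g f"
  unfolding l2inner_def
  by (simp add: mult.commute flip: Bochner_Integration.integral_cnj)

lemma l2norm_add_sq:
  assumes "f \<in> L2" "g \<in> L2"
  shows "(l2norm (\<lambda>x. f x + g x))\<^sup>2 = (l2norm f)\<^sup>2 + 2 * Re (l2inner f g) + (l2norm g)\<^sup>2"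
proof -
  note i = integrable_l2inner[OF assms] L2_integrable_norm_sq[OF assms(1)]
    L2_integrable_norm_sq[OF assms(2)]
  have "(cmod (a + b))\<^sup>2 = (cmod a)\<^sup>2 + 2 * Re (cnj a * b) + (cmod b)\<^sup>2" for a b
    unfolding cmod_power2 by (simp add: power2_eq_square algebra_simps)
  then have "(l2norm (\<lambda>x. f x + g x))\<^sup>2 =
      (LINT x|lborel. (cmod (f x))\<^sup>2 + 2 * Re (cnj (f x) * g x) + (cmod (g x))\<^sup>2)"
    by (simp add: l2norm_sq)
  also have "\<dots> = (l2norm f)\<^sup>2 + 2 * (LINT x|lborel. Re (cnj (f x) * g x)) + (l2norm g)\<^sup>2"
    using i by (simp add: l2norm_sq del: times_complex.sel)
  also have "(LINT x|lborel. Re (cnj (f x) * g x)) = Re (l2inner f g)"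
    using i by (simp add: l2inner_def del: times_complex.sel)
  finally show ?thesis .
qed

lemma l2norm_cmult: "l2norm (\<lambda>x. c * f x) = cmod c * l2norm f"
  by (simp add: l2norm_def norm_mult power_mult_distrib real_sqrt_mult)

lemma l2norm_minus_commute: "l2norm (\<lambda>x. f x - g x) = l2norm (\<lambda>x. g x - f x)"
  by (simp add: l2norm_def norm_minus_commute)

lemma l2norm_eq_0_iff:
  assumes "f \<in> L2"
  shows "l2norm f = 0 \<longleftrightarrow> (AE x in lborel. f x = 0)"
  using integral_nonneg_eq_0_iff_AE[OF L2_integrable_norm_sq[OF assms]]
  by (simp add: l2norm_def)

lemma l2inner_cauchy_schwarz:
  assumes "f \<in> L2" "g \<in> L2"
  shows "cmod (l2inner f g) \<le> l2norm f * l2norm g"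
proof (cases "l2norm g = 0")
  case True
  then have "AE x in lborel. g x = 0"
    using assms(2) by (simp add: l2norm_eq_0_iff)
  then have "l2inner f g = 0"
    unfolding l2inner_def by (intro integral_eq_zero_AE) auto
  then show ?thesis by simp
next
  case False
  \<comment> \<open>This \<open>c\<close> minimises the norm of f + c g; nonnegativity of the
    minimum is the inequality.\<close>
  define c where "c = - cnj (l2inner f g) / (l2norm g)\<^sup>2"
  have "0 \<le> (l2norm (\<lambda>x. f x + c * g x))\<^sup>2" by simp
  also have "\<dots> = (l2norm f)\<^sup>2 + 2 * Re (c * l2inner f g) + (cmod c * l2norm g)\<^sup>2"
    by (simp add: l2norm_add_sq assms L2_cmult l2inner_cmult_right l2norm_cmult
        del: times_complex.sel)
  also have "c * l2inner f g = - complex_of_real ((cmod (l2inner f g))\<^sup>2 / (l2norm g)\<^sup>2)"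
    using complex_norm_square[of "l2inner f g"] by (simp add: c_def mult.commute)
  also have "cmod c * l2norm g = cmod (l2inner f g) / l2norm g"
    using False by (simp add: c_def norm_divide norm_mult power2_eq_square)
  finally have "(cmod (l2inner f g))\<^sup>2 / (l2norm g)\<^sup>2 \<le> (l2norm f)\<^sup>2"
    by (simp add: power_divide)
  then have "(cmod (l2inner f g))\<^sup>2 \<le> (l2norm f * l2norm g)\<^sup>2"
    using False by (simp add: divide_simps power_mult_distrib split: if_splits)
  then show ?thesis
    by (rule power2_le_imp_le) simp
qed

lemma l2norm_triangle:
  assumes "f \<in> L2" "g \<in> L2"
  shows "l2norm (\<lambda>x. f x + g x) \<le> l2norm f + l2norm g"
proof (rule power2_le_imp_le)
  have "Re (l2inner f g) \<le> l2norm f * l2norm g"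
    using complex_Re_le_cmod l2inner_cauchy_schwarz[OF assms] by (rule order_trans)
  then show "(l2norm (\<lambda>x. f x + g x))\<^sup>2 \<le> (l2norm f + l2norm g)\<^sup>2"
    by (simp add: l2norm_add_sq assms power2_sum)
qed simp

lemma l2norm_triangle_diff:
  assumes "f \<in> L2" "g \<in> L2"
  shows "l2norm (\<lambda>x. f x - g x) \<le> l2norm f + l2norm g"
  using l2norm_triangle[OF assms(1) L2_cmult[OF assms(2), of "-1"]]
  by (simp add: l2norm_cmult del: mult_minus1) (simp add: l2norm_def)

lemma l2norm_triangle_3:
  assumes "f \<in> L2" "g \<in> L2" "h \<in> L2"
  shows "l2norm (\<lambda>x. f x - h x) \<le> l2norm (\<lambda>x. f x - g x) + l2norm (\<lambda>x. g x - h x)"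
  using l2norm_triangle[OF L2_diff[OF assms(1,2)] L2_diff[OF assms(2,3)]] by simp

lemma tendsto_l2inner:
  assumes f: "f \<in> L2" "\<And>n::nat. F n \<in> L2" "(\<lambda>n. l2norm (\<lambda>x. f x - F n x)) \<longlonglongrightarrow> 0"
    and g: "g \<in> L2" "\<And>n::nat. G n \<in> L2" "(\<lambda>n. l2norm (\<lambda>x. g x - G n x)) \<longlonglongrightarrow> 0"
  shows "(\<lambda>n. l2inner (F n) (G n)) \<longlonglongrightarrow> l2inner f g"
proof (rule Lim_null[THEN iffD2], rule Lim_null_comparison)
  let ?d = "\<lambda>n. l2norm (\<lambda>x. f x - F n x)" and ?e = "\<lambda>n. l2norm (\<lambda>x. g x - G n x)"
  show "(\<lambda>n. ?d n * l2norm g + (l2norm f + ?d n) * ?e n) \<longlonglongrightarrow> 0"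
    by (rule tendsto_eq_intros f(3) g(3) | simp)+
  show "\<forall>\<^sub>F n in sequentially. norm (l2inner (F n) (G n) - l2inner f g)
      \<le> ?d n * l2norm g + (l2norm f + ?d n) * ?e n"
  proof (intro always_eventually allI)
    fix n
    have "l2inner (F n) (G n) - l2inner f g =
      - (l2inner (\<lambda>x. f x - F n x) g + l2inner (F n) (\<lambda>x. g x - G n x))"
      by (simp add: l2inner_diff_left l2inner_diff_right f g)
    then have "norm (l2inner (F n) (G n) - l2inner f g) \<le>
        cmod (l2inner (\<lambda>x. f x - F n x) g) + cmod (l2inner (F n) (\<lambda>x. g x - G n x))"
      by (simp only: norm_minus_cancel norm_triangle_ineq)
    also have "\<dots> \<le> ?d n * l2norm g + l2norm (F n) * ?e n"
      by (intro add_mono l2inner_cauchy_schwarz L2_diff f g)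
    \<comment> \<open>No uniform bound on \<open>F n\<close> is assumed; it is inherited from the
      distance to \<open>f\<close>.\<close>
    also have "l2norm (F n) \<le> l2norm f + ?d n"
      using l2norm_triangle_diff[OF f(1) L2_diff[OF f(1) f(2)], of n] by simp
    finally show "norm (l2inner (F n) (G n) - l2inner f g)
      \<le> ?d n * l2norm g + (l2norm f + ?d n) * ?e n"
      by (simp add: mult_right_mono)
  qed
qed


section \<open>Exponentials of skew-symmetric operators\<close>

text \<open>The \<open>L2\<close> premises are explicit because the graphs of the generators are cut
  out by \<open>schwartz\<close> alone; pairs in an \<open>l2_closure\<close> meet them by
  definition.\<close>

definition skew_symmetric :: "opgraph \<Rightarrow> bool" where
  "skew_symmetric A \<longleftrightarrow> (\<forall>f g f' g'. (f, g) \<in> A \<longrightarrow> (f', g') \<in> A \<longrightarrow>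
     f \<in> L2 \<longrightarrow> g \<in> L2 \<longrightarrow> f' \<in> L2 \<longrightarrow> g' \<in> L2 \<longrightarrow> l2inner g f' + l2inner f g' = 0)"

lemma l2_closure_sequence:
  assumes "(f, g) \<in> l2_closure A"
  obtains F G where "\<And>n::nat. (F n, G n) \<in> A" "\<And>n. F n \<in> L2" "\<And>n. G n \<in> L2"
    "(\<lambda>n. l2norm (\<lambda>x. f x - F n x)) \<longlonglongrightarrow> 0" "(\<lambda>n. l2norm (\<lambda>x. g x - G n x)) \<longlonglongrightarrow> 0"
proof -
  have "\<exists>f' g'. (f', g') \<in> A \<and> f' \<in> L2 \<and> g' \<in> L2 \<and>
      l2norm (\<lambda>x. f x - f' x) < 1 / Suc n \<and> l2norm (\<lambda>x. g x - g' x) < 1 / Suc n" for n :: nat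
    using assms by (simp add: l2_closure_def)
  then have "\<exists>F. \<forall>n. \<exists>g'. (F n, g') \<in> A \<and> F n \<in> L2 \<and> g' \<in> L2 \<and>
      l2norm (\<lambda>x. f x - F n x) < 1 / Suc n \<and> l2norm (\<lambda>x. g x - g' x) < 1 / Suc n"
    by (intro choice allI)
  then obtain F where "\<forall>n. \<exists>g'. (F n, g') \<in> A \<and> F n \<in> L2 \<and> g' \<in> L2 \<and>
      l2norm (\<lambda>x. f x - F n x) < 1 / Suc n \<and> l2norm (\<lambda>x. g x - g' x) < 1 / Suc n"
    by blast
  from choice[OF this] obtain G where *: "\<And>n. (F n, G n) \<in> A \<and> F n \<in> L2 \<and> G n \<in> L2 \<and>
      l2norm (\<lambda>x. f x - F n x) < 1 / Suc n \<and> l2norm (\<lambda>x. g x - G n x) < 1 / Suc n"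
    by blast
  have lim: "(\<lambda>n. 1 / real (Suc n)) \<longlonglongrightarrow> 0"
    using LIMSEQ_inverse_real_of_nat by (simp add: inverse_eq_divide)
  have "(\<lambda>n. l2norm (\<lambda>x. f x - F n x)) \<longlonglongrightarrow> 0" "(\<lambda>n. l2norm (\<lambda>x. g x - G n x)) \<longlonglongrightarrow> 0"
    by (rule tendsto_sandwich[OF _ _ tendsto_const lim];
        use * in \<open>auto intro!: always_eventually less_imp_le\<close>)+
  with * that show ?thesis by blast
qed

lemma l2_closure_L2: "(f, g) \<in> l2_closure A \<Longrightarrow> f \<in> L2 \<and> g \<in> L2"
  by (simp add: l2_closure_def)

text \<open>Skew symmetry is an identity between inner products, hence stable under limits of graph
  pairs.\<close>

lemma skew_symmetric_l2_closure:
  assumes "skew_symmetric A"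
  shows "skew_symmetric (l2_closure A)"
  unfolding skew_symmetric_def
proof (intro allI impI)
  fix f g f' g'
  assume fg: "(f, g) \<in> l2_closure A" and fg': "(f', g') \<in> l2_closure A"
  assume L2: "f \<in> L2" "g \<in> L2" "f' \<in> L2" "g' \<in> L2"
  obtain F G where F: "\<And>n::nat. (F n, G n) \<in> A" "\<And>n. F n \<in> L2" "\<And>n. G n \<in> L2"
    "(\<lambda>n. l2norm (\<lambda>x. f x - F n x)) \<longlonglongrightarrow> 0" "(\<lambda>n. l2norm (\<lambda>x. g x - G n x)) \<longlonglongrightarrow> 0"
    using l2_closure_sequence[OF fg] by blast
  obtain F' G' where F': "\<And>n::nat. (F' n, G' n) \<in> A" "\<And>n. F' n \<in> L2" "\<And>n. G' n \<in> L2"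
    "(\<lambda>n. l2norm (\<lambda>x. f' x - F' n x)) \<longlonglongrightarrow> 0" "(\<lambda>n. l2norm (\<lambda>x. g' x - G' n x)) \<longlonglongrightarrow> 0"
    using l2_closure_sequence[OF fg'] by blast
  have "(\<lambda>n. l2inner (G n) (F' n) + l2inner (F n) (G' n)) \<longlonglongrightarrow> l2inner g f' + l2inner f g'"
    by (intro tendsto_add tendsto_l2inner L2 F F')
  moreover have "l2inner (G n) (F' n) + l2inner (F n) (G' n) = 0" for n
    using assms F F' unfolding skew_symmetric_def by blast
  ultimately show "l2inner g f' + l2inner f g' = 0"
    by (simp add: LIMSEQ_const_iff)
qed

text \<open>The graph is an arbitrary set of pairs, so the difference of two pairs need not belong
  to it. Expanding the inner product reduces the claim to skew symmetry of the given pairs, each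
  with itself and one with the other.\<close>

lemma Re_l2inner_skew:
  assumes "skew_symmetric A" "(f, g) \<in> A" "(f', g') \<in> A"
    and "f \<in> L2" "g \<in> L2" "f' \<in> L2" "g' \<in> L2"
  shows "Re (l2inner (\<lambda>x. f x - f' x) (\<lambda>x. g x - g' x)) = 0"
proof -
  have *: "l2inner g f + l2inner f g = 0" "l2inner g' f' + l2inner f' g' = 0"
     "l2inner g f' + l2inner f g' = 0"
    using assms unfolding skew_symmetric_def by blast+
  have "Re (l2inner f g) = Re (l2inner g f)" "Re (l2inner f' g') = Re (l2inner g' f')"
    "Re (l2inner f' g) = Re (l2inner g f')"
    by (metis cnj_l2inner cnj.simps(1))+
  with *[THEN arg_cong[where f=Re]] show ?thesis
    by (simp add: l2inner_diff_left l2inner_diff_right L2_diff assms)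
qed

text \<open>Energy method: the squared norm of the difference w of two solutions has derivative 2 Re
  <w, z>, with z the difference of their velocities, and skew symmetry makes this 0.\<close>

lemma flow_graph_isometric:
  assumes skew: "skew_symmetric G" and L2: "\<And>f g. (f, g) \<in> G \<Longrightarrow> f \<in> L2 \<and> g \<in> L2"
    and "(f, g) \<in> flow_graph G" "(f', g') \<in> flow_graph G"
  shows "l2norm (\<lambda>x. g x - g' x) = l2norm (\<lambda>x. f x - f' x)"
proof -
  obtain u v where u: "u 0 = f" "u 1 = g" "\<And>t. (u t, v t) \<in> G"
    "\<And>t. ((\<lambda>h. l2norm (\<lambda>x. (u (t + h) x - u t x) / complex_of_real h - v t x)) \<longlongrightarrow> 0) (at 0)"
    using assms(3) unfolding flow_graph_def by blast
  obtain u' v' where u': "u' 0 = f'" "u' 1 = g'" "\<And>t. (u' t, v' t) \<in> G"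
    "\<And>t. ((\<lambda>h. l2norm (\<lambda>x. (u' (t + h) x - u' t x) / complex_of_real h - v' t x)) \<longlongrightarrow> 0) (at 0)"
    using assms(4) unfolding flow_graph_def by blast
  have L: "u t \<in> L2" "v t \<in> L2" "u' t \<in> L2" "v' t \<in> L2" for t
    using L2 u(3) u'(3) by blast+
  define w where "w = (\<lambda>t x. u t x - u' t x)"
  define z where "z = (\<lambda>t x. v t x - v' t x)"
  define q where "q = (\<lambda>t h x. (w (t + h) x - w t x) / complex_of_real h - z t x)"
  define n where "n = (\<lambda>t. (l2norm (w t))\<^sup>2)"
  have w: "w t \<in> L2" and z: "z t \<in> L2" for t
    by (simp_all add: w_def z_def L2_diff L)
  have div_L2: "(\<lambda>x. k x / c) \<in> L2" if "k \<in> L2" for k and c :: complex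
    using L2_cmult[OF that, of "1 / c"] by simp
  have q: "q t h \<in> L2" for t h
    unfolding q_def by (intro L2_diff div_L2 w z)
  have q0: "((\<lambda>h. l2norm (q t h)) \<longlongrightarrow> 0) (at 0)" for t
  proof (rule tendsto_sandwich[OF _ _ tendsto_const])
    let ?a = "\<lambda>h. l2norm (\<lambda>x. (u (t + h) x - u t x) / complex_of_real h - v t x)"
    let ?b = "\<lambda>h. l2norm (\<lambda>x. (u' (t + h) x - u' t x) / complex_of_real h - v' t x)"
    show "((\<lambda>h. ?a h + ?b h) \<longlongrightarrow> 0) (at 0)"
      using tendsto_add[OF u(4) u'(4)] by simp
    have "q t h = (\<lambda>x. ((u (t + h) x - u t x) / complex_of_real h - v t x) -
        ((u' (t + h) x - u' t x) / complex_of_real h - v' t x))" for h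
      by (simp add: q_def w_def z_def add_divide_distrib diff_divide_distrib algebra_simps)
    then show "\<forall>\<^sub>F h in at 0. l2norm (q t h) \<le> ?a h + ?b h"
      by (auto intro!: always_eventually l2norm_triangle_diff L2_diff div_L2 L)
  qed simp
  have "DERIV n t :> 0" for t
    unfolding DERIV_def
  proof (rule Lim_null_comparison)
    \<comment> \<open>With w (t + h) = w t + h (z t + q t h), the term Re <w, z> drops out of the
      difference quotient. What remains is h |z + q|^2 + 2 Re <w, q>, bounded by the triangle and
      Cauchy-Schwarz inequalities.\<close>
    let ?B = "\<lambda>h. \<bar>h\<bar> * (l2norm (z t) + l2norm (q t h))\<^sup>2 + 2 * l2norm (w t) * l2norm (q t h)"
    show "(?B \<longlongrightarrow> 0) (at 0)"
      by (rule tendsto_eq_intros q0 | simp)+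
    show "\<forall>\<^sub>F h in at 0. norm ((n (t + h) - n t) / h) \<le> ?B h"
      unfolding eventually_at_filter
    proof (intro always_eventually allI impI)
      fix h :: real assume h: "h \<noteq> 0"
      have zq: "(\<lambda>x. z t x + q t h x) \<in> L2" by (intro L2_add z q)
      have "w (t + h) = (\<lambda>x. w t x + complex_of_real h * (z t x + q t h x))"
        using h by (auto simp: q_def field_simps)
      then have "n (t + h) = n t + 2 * Re (complex_of_real h * l2inner (w t) (\<lambda>x. z t x + q t h x))
         + (\<bar>h\<bar> * l2norm (\<lambda>x. z t x + q t h x))\<^sup>2"
        by (simp add: n_def l2norm_add_sq w L2_cmult zq l2inner_cmult_right l2norm_cmult
            del: times_complex.sel)
      also have "l2inner (w t) (\<lambda>x. z t x + q t h x) = l2inner (w t) (z t) + l2inner (w t) (q t h)"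
        by (intro l2inner_add_right w z q)
      also have "Re (complex_of_real h * \<dots>) = h * Re (l2inner (w t) (q t h))"
        using Re_l2inner_skew[OF skew u(3)[of t] u'(3)[of t]] by (simp add: L w_def z_def)
      finally have "(n (t + h) - n t) / h =
          h * (l2norm (\<lambda>x. z t x + q t h x))\<^sup>2 + 2 * Re (l2inner (w t) (q t h))"
        using h by (simp add: power_mult_distrib field_simps power2_eq_square)
      also have "norm \<dots> \<le> \<bar>h\<bar> * (l2norm (\<lambda>x. z t x + q t h x))\<^sup>2 + 2 * cmod (l2inner (w t) (q t h))"
        using abs_Re_le_cmod[of "l2inner (w t) (q t h)"]
        by (simp only: real_norm_def) (rule order_trans[OF abs_triangle_ineq], simp add: abs_mult)
      also have "\<dots> \<le> ?B h"
        using l2inner_cauchy_schwarz[OF w q, of t t h]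
        by (intro add_mono mult_left_mono power_mono l2norm_triangle z q) auto
      finally show "norm ((n (t + h) - n t) / h) \<le> ?B h" .
    qed
  qed
  then have "n 1 = n 0"
    using DERIV_isconst_all by blast
  then show ?thesis
    by (simp add: n_def w_def u u' power2_eq_iff_nonneg)
qed

lemma l2_closure_flow_isometric:
  assumes skew: "skew_symmetric A"
    and "(f, g) \<in> l2_closure (flow_graph (l2_closure A))"
    and "(f', g') \<in> l2_closure (flow_graph (l2_closure A))"
  shows "l2norm (\<lambda>x. g x - g' x) = l2norm (\<lambda>x. f x - f' x)"
proof -
  let ?H = "flow_graph (l2_closure A)"
  obtain F G where F: "\<And>n::nat. (F n, G n) \<in> ?H" "\<And>n. F n \<in> L2" "\<And>n. G n \<in> L2"
    "(\<lambda>n. l2norm (\<lambda>x. f x - F n x)) \<longlonglongrightarrow> 0" "(\<lambda>n. l2norm (\<lambda>x. g x - G n x)) \<longlonglongrightarrow> 0"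
    using l2_closure_sequence[OF assms(2)] by blast
  obtain F' G' where F': "\<And>n::nat. (F' n, G' n) \<in> ?H" "\<And>n. F' n \<in> L2" "\<And>n. G' n \<in> L2"
    "(\<lambda>n. l2norm (\<lambda>x. f' x - F' n x)) \<longlonglongrightarrow> 0" "(\<lambda>n. l2norm (\<lambda>x. g' x - G' n x)) \<longlonglongrightarrow> 0"
    using l2_closure_sequence[OF assms(3)] by blast
  have L: "f \<in> L2" "g \<in> L2" "f' \<in> L2" "g' \<in> L2"
    using assms(2,3) by (auto dest: l2_closure_L2)
  have lim: "(\<lambda>n. l2norm (\<lambda>x. H n x - H' n x)) \<longlonglongrightarrow> l2norm (\<lambda>x. h x - h' x)"
    if h: "h \<in> L2" "h' \<in> L2" "\<And>n::nat. H n \<in> L2" "\<And>n. H' n \<in> L2"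
      and l: "(\<lambda>n. l2norm (\<lambda>x. h x - H n x)) \<longlonglongrightarrow> 0" "(\<lambda>n. l2norm (\<lambda>x. h' x - H' n x)) \<longlonglongrightarrow> 0"
    for h h' H H'
  proof (rule Lim_null[THEN iffD2], rule Lim_null_comparison)
    let ?b = "\<lambda>n. l2norm (\<lambda>x. h x - H n x) + l2norm (\<lambda>x. h' x - H' n x)"
    show "?b \<longlonglongrightarrow> 0" using tendsto_add[OF l] by simp
    have "\<bar>l2norm (\<lambda>x. H n x - H' n x) - l2norm (\<lambda>x. h x - h' x)\<bar> \<le> ?b n" for n
      using l2norm_triangle_3[OF h(3,1,4), of n n] l2norm_triangle_3[OF h(1,2,4), of n]
        l2norm_triangle_3[OF h(1,3,2), of n] l2norm_triangle_3[OF h(3,4,2), of n n]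
        l2norm_minus_commute[of h "H n"] l2norm_minus_commute[of h' "H' n"]
      by linarith
    then show "\<forall>\<^sub>F n in sequentially.
        norm (l2norm (\<lambda>x. H n x - H' n x) - l2norm (\<lambda>x. h x - h' x)) \<le> ?b n"
      by simp
  qed
  have "l2norm (\<lambda>x. G n x - G' n x) = l2norm (\<lambda>x. F n x - F' n x)" for n
    by (rule flow_graph_isometric[OF skew_symmetric_l2_closure[OF skew] l2_closure_L2 F(1) F'(1)])
  then show ?thesis
    using lim[OF L(1,3) F(2) F'(2) F(4) F'(4)] lim[OF L(2,4) F(3) F'(3) F(5) F'(5)]
    by (simp add: LIMSEQ_unique)
qed

text \<open>The given flow pair witnesses the \<open>SOME\<close>, and two images of the same vector
  have distance 0 by isometry. The start value is allowed to differ from \<open>f\<close> on a null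
  set so that the result of one exponential can be fed into another.\<close>

lemma exp_op_eq_AE:
  assumes skew: "skew_symmetric A"
    and flow: "(f, g) \<in> flow_graph (l2_closure A)"
    and f': "f' \<in> L2" "AE x in lborel. f' x = f x"
  shows "exp_op A f' \<in> L2 \<and> (AE x in lborel. exp_op A f' x = g x)"
proof -
  let ?H = "l2_closure (flow_graph (l2_closure A))"
  have "f \<in> L2 \<and> g \<in> L2"
    using flow l2_closure_L2 unfolding flow_graph_def by blast
  then have L: "f \<in> L2" "g \<in> L2" by simp_all
  have d0: "l2norm (\<lambda>x. f' x - f x) = 0"
    using f' by (subst l2norm_eq_0_iff[OF L2_diff[OF f'(1) L(1)]]) auto
  moreover have "l2norm (\<lambda>x. g x - g x) = 0" by (simp add: l2norm_def)
  ultimately have "\<forall>\<epsilon>>0. (f, g) \<in> flow_graph (l2_closure A) \<and> f \<in> L2 \<and> g \<in> L2 \<and>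
      l2norm (\<lambda>x. f' x - f x) < \<epsilon> \<and> l2norm (\<lambda>x. g x - g x) < \<epsilon>"
    using L flow by simp
  then have H': "(f', g) \<in> ?H"
    unfolding l2_closure_def[of "flow_graph (l2_closure A)"] using L f'(1) by blast
  then have H: "(f', exp_op A f') \<in> ?H"
    using someI[of "\<lambda>g. (f', g) \<in> ?H"] by (simp add: exp_op_def)
  have "l2norm (\<lambda>x. exp_op A f' x - g x) = l2norm (\<lambda>x. f' x - f' x)"
    by (rule l2_closure_flow_isometric[OF skew H H'])
  then have "l2norm (\<lambda>x. exp_op A f' x - g x) = 0"
    by (simp add: l2norm_def)
  moreover have E: "exp_op A f' \<in> L2" using l2_closure_L2[OF H] by simp
  ultimately show ?thesis
    by (auto simp: l2norm_eq_0_iff L2_diff L)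
qed

section \<open>Skew symmetry of the generators on the Schwartz space\<close>

lemma integral_derivative_eq_0:
  fixes F f :: "real \<Rightarrow> complex"
  assumes F: "\<And>x. (F has_vector_derivative f x) (at x)"
    and f: "\<And>x. isCont f x" "integrable lborel f"
    and lim: "(F \<longlongrightarrow> 0) at_top" "(F \<longlongrightarrow> 0) at_bot"
  shows "(LINT x|lborel. f x) = 0"
proof -
  have "(LBINT x=-\<infinity>..\<infinity>. f x) = 0 - 0"
  proof (rule interval_integral_FTC_integrable[where F=F])
    show "set_integrable lborel (einterval (- \<infinity>) \<infinity>) f"
      using f(2) by (simp add: set_integrable_def einterval_def)
  qed (use assms in \<open>simp_all add: ereal_tendsto_simps1\<close>)
  then show ?thesis
    by (simp add: interval_lebesgue_integral_def einterval_def set_lebesgue_integral_def)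
qed

lemma tendsto_0_if_bounded_times_id:
  fixes F :: "real \<Rightarrow> complex"
  assumes "bounded (range (\<lambda>x. complex_of_real x * F x))"
  shows "(F \<longlongrightarrow> 0) at_top" "(F \<longlongrightarrow> 0) at_bot"
proof -
  obtain C where C: "\<And>x. cmod (complex_of_real x * F x) \<le> C"
    using assms by (auto simp: bounded_iff)
  have le: "cmod (F x) \<le> C * inverse \<bar>x\<bar>" if "x \<noteq> 0" for x
    using C[of x] that by (simp add: norm_mult field_simps)
  have "filterlim (\<lambda>x::real. \<bar>x\<bar>) at_top at_bot"
    using filterlim_at_infinity_imp_norm_at_top[OF filterlim_at_bot_imp_at_infinity[OF filterlim_ident]]
    by simp
  then have "((\<lambda>x::real. inverse \<bar>x\<bar>) \<longlongrightarrow> 0) at_bot"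
    by (rule tendsto_inverse_0_at_top)
  moreover have "((\<lambda>x::real. inverse \<bar>x\<bar>) \<longlongrightarrow> 0) at_top"
    by (rule tendsto_inverse_0_at_top[OF filterlim_abs_real])
  ultimately have lim: "((\<lambda>x. C * inverse \<bar>x\<bar>) \<longlongrightarrow> 0) at_top" "((\<lambda>x. C * inverse \<bar>x\<bar>) \<longlongrightarrow> 0) at_bot"
    by (auto intro: tendsto_mult_right_zero)
  show "(F \<longlongrightarrow> 0) at_top"
    by (rule Lim_null_comparison[OF eventually_mono[OF eventually_gt_at_top[of 0] le] lim(1)]) simp
  show "(F \<longlongrightarrow> 0) at_bot"
    by (rule Lim_null_comparison[OF eventually_mono[OF eventually_le_at_bot[of "- 1"] le] lim(2)]) simp
qed

section \<open>Ladder operators and the generators as differential operators\<close>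

lemma annihilation_eq:
  "annihilation f = (\<lambda>x. (complex_of_real x * f x + vector_derivative f (at x)) / complex_of_real (sqrt 2))"
  by (simp add: annihilation_def position_op_def momentum_op_def flip: mult.assoc)

lemma creation_eq:
  "creation f = (\<lambda>x. (complex_of_real x * f x - vector_derivative f (at x)) / complex_of_real (sqrt 2))"
  by (simp add: creation_def position_op_def momentum_op_def flip: mult.assoc)

context
  fixes f f1 f2 :: wavefun
  assumes f: "\<And>x. (f has_vector_derivative f1 x) (at x)"
    and f1: "\<And>x. (f1 has_vector_derivative f2 x) (at x)"
begin

text \<open>\<open>annihilation\<close> is (x + d) / sqrt 2 with d the derivative; the isolated
  \<open>f x\<close> is the commutator of d and x. For \<open>creation\<close>, which is (x - d) /
  sqrt 2, it changes sign.\<close>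

lemma annihilation_twice:
  "annihilation (annihilation f) x =
    ((complex_of_real x)\<^sup>2 * f x + 2 * complex_of_real x * f1 x + f x + f2 x) / 2"
proof -
  define s where "s = complex_of_real (sqrt 2)"
  have s: "s \<noteq> 0" "s * s = 2" by (auto simp: s_def simp flip: of_real_mult)
  have eq: "annihilation f = (\<lambda>x. (complex_of_real x * f x + f1 x) / s)"
    by (simp add: annihilation_eq s_def vector_derivative_at[OF f])
  have "(annihilation f has_vector_derivative
      (f x + complex_of_real x * f1 x + f2 x) / s) (at x)"
    unfolding eq
    by (rule derivative_eq_intros f f1 | simp)+
  then have "annihilation (annihilation f) x =
     (complex_of_real x * ((complex_of_real x * f x + f1 x) / s) +
      (f x + complex_of_real x * f1 x + f2 x) / s) / s"
    by (simp add: annihilation_eq[of "annihilation f"] vector_derivative_at flip: s_def)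
       (simp add: eq)
  also have "\<dots> = (complex_of_real x * (complex_of_real x * f x + f1 x) +
      (f x + complex_of_real x * f1 x + f2 x)) / (s * s)"
    by (simp add: s(1) field_simps)
  finally show ?thesis
    by (simp add: s(2) power2_eq_square algebra_simps)
qed

lemma creation_twice:
  "creation (creation f) x =
    ((complex_of_real x)\<^sup>2 * f x - 2 * complex_of_real x * f1 x - f x + f2 x) / 2"
proof -
  define s where "s = complex_of_real (sqrt 2)"
  have s: "s \<noteq> 0" "s * s = 2" by (auto simp: s_def simp flip: of_real_mult)
  have eq: "creation f = (\<lambda>x. (complex_of_real x * f x - f1 x) / s)"
    by (simp add: creation_eq s_def vector_derivative_at[OF f])
  have "(creation f has_vector_derivative
      (f x + complex_of_real x * f1 x - f2 x) / s) (at x)"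
    unfolding eq
    by (rule derivative_eq_intros f f1 | simp)+
  then have "creation (creation f) x =
     (complex_of_real x * ((complex_of_real x * f x - f1 x) / s) -
      (f x + complex_of_real x * f1 x - f2 x) / s) / s"
    by (simp add: creation_eq[of "creation f"] vector_derivative_at flip: s_def)
       (simp add: eq)
  also have "\<dots> = (complex_of_real x * (complex_of_real x * f x - f1 x) -
      (f x + complex_of_real x * f1 x - f2 x)) / (s * s)"
    by (simp add: s(1) field_simps)
  finally show ?thesis
    by (simp add: s(2) power2_eq_square algebra_simps)
qed

text \<open>The second bracket is (x d + d x) f. So the symmetric operator x^2 + d^2 gets the
  imaginary coefficient \<open>cnj \<zeta> - \<zeta>\<close> and the skew-symmetric one gets the
  real coefficient \<open>cnj \<zeta> + \<zeta>\<close>; this separation is the source of the skew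
  symmetry.\<close>

lemma squeezing_generator_eq:
  "(cnj \<zeta> * annihilation (annihilation f) x - \<zeta> * creation (creation f) x) / 2 =
    ((cnj \<zeta> - \<zeta>) * ((complex_of_real x)\<^sup>2 * f x + f2 x) +
     (cnj \<zeta> + \<zeta>) * (2 * complex_of_real x * f1 x + f x)) / 4"
  unfolding annihilation_twice creation_twice by (simp add: field_simps)

lemma displacement_generator_eq:
  "\<alpha> * creation f x - cnj \<alpha> * annihilation f x =
    ((\<alpha> - cnj \<alpha>) * (complex_of_real x * f x) - (\<alpha> + cnj \<alpha>) * f1 x) / complex_of_real (sqrt 2)"
  by (simp add: annihilation_eq creation_eq vector_derivative_at[OF f] field_simps)

end

lemma schwartz_derivatives:
  assumes "f \<in> schwartz"
  obtains f1 f2 where "\<And>x. (f has_vector_derivative f1 x) (at x)"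
    "\<And>x. (f1 has_vector_derivative f2 x) (at x)" "\<And>x. isCont f2 x"
    "\<And>m. bounded (range (\<lambda>x. complex_of_real (x ^ m) * f x))"
    "\<And>m. bounded (range (\<lambda>x. complex_of_real (x ^ m) * f1 x))"
proof -
  let ?D = "\<lambda>(g :: wavefun) y. vector_derivative g (at y)"
  have d: "(?D ^^ k) f differentiable at x"
    and b: "bounded (range (\<lambda>x. complex_of_real (x ^ m) * (?D ^^ k) f x))" for k m x
    using assms by (auto simp: schwartz_def)
  have d': "((?D ^^ k) f has_vector_derivative (?D ^^ Suc k) f x) (at x)" for k x
    using d[of k x] by (simp add: vector_derivative_works)
  show ?thesis
  proof (rule that)
    show "(f has_vector_derivative ?D f x) (at x)" for x
      using d'[of 0] by simp
    show "(?D f has_vector_derivative (?D ^^ 2) f x) (at x)" for x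
      using d'[of 1] by (simp add: numeral_2_eq_2)
    \<comment> \<open>Differentiability of the second derivative gives its continuity, required
      later of the integrand in the fundamental theorem of calculus.\<close>
    show "isCont ((?D ^^ 2) f) x" for x
      using d[of 2 x] by (rule differentiable_imp_continuous_within)
    show "bounded (range (\<lambda>x. complex_of_real (x ^ m) * f x))" for m
      using b[of m 0] by simp
    show "bounded (range (\<lambda>x. complex_of_real (x ^ m) * ?D f x))" for m
      using b[of m 1] by simp
  qed
qed

lemma bounded_range_mult:
  fixes f g :: "real \<Rightarrow> complex"
  assumes "bounded (range f)" "bounded (range g)"
  shows "bounded (range (\<lambda>x. f x * g x))"
proof -
  obtain A B where A: "\<And>x. cmod (f x) \<le> A" and B: "\<And>x. cmod (g x) \<le> B"
    using assms by (auto simp: bounded_iff)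
  have "cmod (f x * g x) \<le> A * B" for x
    unfolding norm_mult by (rule mult_mono[OF A B order_trans[OF norm_ge_zero A]]) simp
  then show ?thesis by (auto simp: bounded_iff)
qed

lemma bounded_range_add:
  fixes f g :: "real \<Rightarrow> complex"
  assumes "bounded (range f)" "bounded (range g)"
  shows "bounded (range (\<lambda>x. f x + g x))"
proof -
  obtain A B where A: "\<And>x. cmod (f x) \<le> A" and B: "\<And>x. cmod (g x) \<le> B"
    using assms by (auto simp: bounded_iff)
  have "cmod (f x + g x) \<le> A + B" for x
    by (rule norm_triangle_mono[OF A B])
  then show ?thesis by (auto simp: bounded_iff)
qed

lemma bounded_range_cmult:
  fixes f :: "real \<Rightarrow> complex"
  shows "bounded (range f) \<Longrightarrow> bounded (range (\<lambda>x. c * f x))"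
  by (rule bounded_range_mult) (auto simp: bounded_iff)

lemma bounded_range_cnj:
  "bounded (range f) \<Longrightarrow> bounded (range (\<lambda>x. cnj (f x)))"
  by (auto simp: bounded_iff)

text \<open>Integration by parts over the whole line, with \<open>F\<close> the boundary term. It
  vanishes at both ends because x F is bounded, while its derivative is integrable as a sum of
  products of square-integrable functions.\<close>

lemma skew_symmetricI:
  assumes "\<And>f g f' g'. (f, g) \<in> A \<Longrightarrow> (f', g') \<in> A \<Longrightarrow>
    \<exists>F. (\<forall>x. (F has_vector_derivative (cnj (g x) * f' x + cnj (f x) * g' x)) (at x)) \<and>
      (\<forall>x. isCont (\<lambda>x. cnj (g x) * f' x + cnj (f x) * g' x) x) \<and>
      bounded (range (\<lambda>x. complex_of_real x * F x))"
  shows "skew_symmetric A"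
  unfolding skew_symmetric_def
proof (intro allI impI)
  fix f g f' g'
  assume A: "(f, g) \<in> A" "(f', g') \<in> A"
  assume L: "f \<in> L2" "g \<in> L2" "f' \<in> L2" "g' \<in> L2"
  obtain F where F: "\<And>x. (F has_vector_derivative (cnj (g x) * f' x + cnj (f x) * g' x)) (at x)"
      "\<And>x. isCont (\<lambda>x. cnj (g x) * f' x + cnj (f x) * g' x) x"
      "bounded (range (\<lambda>x. complex_of_real x * F x))"
    using assms[OF A] by blast
  have "(LINT x|lborel. cnj (g x) * f' x + cnj (f x) * g' x) = 0"
    by (rule integral_derivative_eq_0[OF F(1,2) _ tendsto_0_if_bounded_times_id[OF F(3)]])
       (intro Bochner_Integration.integrable_add integrable_l2inner L)
  then show "l2inner g f' + l2inner f g' = 0"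
    by (simp add: l2inner_def integrable_l2inner L)
qed

definition displacement_generator :: "complex \<Rightarrow> opgraph" where
  "displacement_generator \<alpha> = {(f, g). f \<in> schwartz \<and>
     g = (\<lambda>x. \<alpha> * creation f x - cnj \<alpha> * annihilation f x)}"

definition squeezing_generator :: "complex \<Rightarrow> opgraph" where
  "squeezing_generator \<zeta> = {(f, g). f \<in> schwartz \<and>
     g = (\<lambda>x. (cnj \<zeta> * annihilation (annihilation f) x - \<zeta> * creation (creation f) x) / 2)}"

lemma isCont_of_real_complex: "isCont complex_of_real x"
  by (intro continuous_intros)

lemma skew_symmetric_displacement: "skew_symmetric (displacement_generator \<alpha>)"
proof (rule skew_symmetricI)
  fix f g h k
  assume "(f, g) \<in> displacement_generator \<alpha>" "(h, k) \<in> displacement_generator \<alpha>"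
  then have S: "f \<in> schwartz" "h \<in> schwartz"
    and g: "g = (\<lambda>x. \<alpha> * creation f x - cnj \<alpha> * annihilation f x)"
    and k: "k = (\<lambda>x. \<alpha> * creation h x - cnj \<alpha> * annihilation h x)"
    by (auto simp: displacement_generator_def)
  obtain f1 f2 where f: "\<And>x. (f has_vector_derivative f1 x) (at x)"
    "\<And>x. (f1 has_vector_derivative f2 x) (at x)" "\<And>x. isCont f2 x"
    "\<And>m. bounded (range (\<lambda>x. complex_of_real (x ^ m) * f x))"
    "\<And>m. bounded (range (\<lambda>x. complex_of_real (x ^ m) * f1 x))"
    using schwartz_derivatives[OF S(1)] by blast
  obtain h1 h2 where h: "\<And>x. (h has_vector_derivative h1 x) (at x)"
    "\<And>x. (h1 has_vector_derivative h2 x) (at x)" "\<And>x. isCont h2 x"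
    "\<And>m. bounded (range (\<lambda>x. complex_of_real (x ^ m) * h x))"
    "\<And>m. bounded (range (\<lambda>x. complex_of_real (x ^ m) * h1 x))"
    using schwartz_derivatives[OF S(2)] by blast
  define r where "r = inverse (complex_of_real (sqrt 2))"
  have r: "z / complex_of_real (sqrt 2) = r * z" "cnj r = r" for z
    by (simp_all add: r_def field_simps)
  define p where "p = - (r * (\<alpha> + cnj \<alpha>))"
  \<comment> \<open>The terms with multiplication by x cancel since their coefficient is imaginary;
    the derivative terms have a real coefficient and add up to a total derivative.\<close>
  define F where "F = (\<lambda>x. p * (cnj (f x) * h x))"
  have eq: "(\<lambda>x. cnj (g x) * h x + cnj (f x) * k x) =
      (\<lambda>x. p * (cnj (f x) * h1 x + cnj (f1 x) * h x))"
    unfolding g k displacement_generator_eq[OF f(1,2)] displacement_generator_eq[OF h(1,2)] p_def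
    by (simp add: r algebra_simps)
  have c: "isCont f x" "isCont f1 x" "isCont h x" "isCont h1 x" for x
    using f(1,2) h(1,2) has_vector_derivative_continuous by blast+
  show "\<exists>F. (\<forall>x. (F has_vector_derivative (cnj (g x) * h x + cnj (f x) * k x)) (at x)) \<and>
      (\<forall>x. isCont (\<lambda>x. cnj (g x) * h x + cnj (f x) * k x) x) \<and>
      bounded (range (\<lambda>x. complex_of_real x * F x))"
  proof (intro exI[of _ F] conjI allI)
    show "(F has_vector_derivative (cnj (g x) * h x + cnj (f x) * k x)) (at x)" for x
      unfolding fun_cong[OF eq] F_def
      by (rule derivative_eq_intros f(1) h(1) has_vector_derivative_cnj | simp)+
    show "isCont (\<lambda>x. cnj (g x) * h x + cnj (f x) * k x) x" for x
      unfolding eq by (intro continuous_intros c)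
    have "bounded (range (\<lambda>x. p *
        (cnj (complex_of_real (x ^ 0) * f x) * (complex_of_real (x ^ 1) * h x))))"
      by (intro bounded_range_cmult bounded_range_mult bounded_range_cnj f h)
    then show "bounded (range (\<lambda>x. complex_of_real x * F x))"
      by (simp add: F_def mult_ac)
  qed
qed

lemma skew_symmetric_squeezing: "skew_symmetric (squeezing_generator \<zeta>)"
proof (rule skew_symmetricI)
  fix f g h k
  assume "(f, g) \<in> squeezing_generator \<zeta>" "(h, k) \<in> squeezing_generator \<zeta>"
  then have S: "f \<in> schwartz" "h \<in> schwartz"
    and g: "g = (\<lambda>x. (cnj \<zeta> * annihilation (annihilation f) x - \<zeta> * creation (creation f) x) / 2)"
    and k: "k = (\<lambda>x. (cnj \<zeta> * annihilation (annihilation h) x - \<zeta> * creation (creation h) x) / 2)"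
    by (auto simp: squeezing_generator_def)
  obtain f1 f2 where f: "\<And>x. (f has_vector_derivative f1 x) (at x)"
    "\<And>x. (f1 has_vector_derivative f2 x) (at x)" "\<And>x. isCont f2 x"
    "\<And>m. bounded (range (\<lambda>x. complex_of_real (x ^ m) * f x))"
    "\<And>m. bounded (range (\<lambda>x. complex_of_real (x ^ m) * f1 x))"
    using schwartz_derivatives[OF S(1)] by blast
  obtain h1 h2 where h: "\<And>x. (h has_vector_derivative h1 x) (at x)"
    "\<And>x. (h1 has_vector_derivative h2 x) (at x)" "\<And>x. isCont h2 x"
    "\<And>m. bounded (range (\<lambda>x. complex_of_real (x ^ m) * h x))"
    "\<And>m. bounded (range (\<lambda>x. complex_of_real (x ^ m) * h1 x))"
    using schwartz_derivatives[OF S(2)] by blast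
  define c :: complex where "c = 1 / 4"
  have c: "z / 4 = c * z" "cnj c = c" for z by (simp_all add: c_def)
  define p where "p = c * (cnj \<zeta> - \<zeta>)"
  define q where "q = 2 * c * (cnj \<zeta> + \<zeta>)"
  \<comment> \<open>As \<open>p\<close> is imaginary and \<open>q\<close> real, the x^2 terms
    cancel, the second derivatives form the derivative of the Wronskian of \<open>cnj f\<close> and
    \<open>h\<close>, and the rest is the derivative of x times \<open>cnj f\<close> times
    \<open>h\<close>.\<close>
  define F where "F = (\<lambda>x. p * (cnj (f x) * h1 x) + (- p) * (cnj (f1 x) * h x) +
      q * (complex_of_real x * (cnj (f x) * h x)))"
  have eq: "(\<lambda>x. cnj (g x) * h x + cnj (f x) * k x) =
      (\<lambda>x. p * (cnj (f x) * h2 x + cnj (f1 x) * h1 x) + (- p) * (cnj (f1 x) * h1 x + cnj (f2 x) * h x) +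
        q * (complex_of_real x * (cnj (f x) * h1 x + cnj (f1 x) * h x) + cnj (f x) * h x))"
    unfolding g k squeezing_generator_eq[OF f(1,2)] squeezing_generator_eq[OF h(1,2)] p_def q_def
    by (simp add: c algebra_simps)
  have c: "isCont f x" "isCont f1 x" "isCont h x" "isCont h1 x" for x
    using f(1,2) h(1,2) has_vector_derivative_continuous by blast+
  show "\<exists>F. (\<forall>x. (F has_vector_derivative (cnj (g x) * h x + cnj (f x) * k x)) (at x)) \<and>
      (\<forall>x. isCont (\<lambda>x. cnj (g x) * h x + cnj (f x) * k x) x) \<and>
      bounded (range (\<lambda>x. complex_of_real x * F x))"
  proof (intro exI[of _ F] conjI allI)
    show "(F has_vector_derivative (cnj (g x) * h x + cnj (f x) * k x)) (at x)" for x
      unfolding fun_cong[OF eq] F_def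
      by (rule derivative_eq_intros f(1,2) h(1,2) has_vector_derivative_cnj | simp)+
    show "isCont (\<lambda>x. cnj (g x) * h x + cnj (f x) * k x) x" for x
      unfolding eq by (intro continuous_intros c f h isCont_of_real_complex)
    have "bounded (range (\<lambda>x.
        p * (cnj (complex_of_real (x ^ 0) * f x) * (complex_of_real (x ^ 1) * h1 x)) +
        (- p) * (cnj (complex_of_real (x ^ 0) * f1 x) * (complex_of_real (x ^ 1) * h x)) +
        q * (cnj (complex_of_real (x ^ 0) * f x) * (complex_of_real (x ^ 2) * h x))))"
      by (intro bounded_range_add bounded_range_cmult bounded_range_mult bounded_range_cnj f h)
    also have "(\<lambda>x.
        p * (cnj (complex_of_real (x ^ 0) * f x) * (complex_of_real (x ^ 1) * h1 x)) +
        (- p) * (cnj (complex_of_real (x ^ 0) * f1 x) * (complex_of_real (x ^ 1) * h x)) +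
        q * (cnj (complex_of_real (x ^ 0) * f x) * (complex_of_real (x ^ 2) * h x))) =
        (\<lambda>x. complex_of_real x * F x)"
      by (simp add: F_def power2_eq_square algebra_simps)
    finally show "bounded (range (\<lambda>x. complex_of_real x * F x))" .
  qed
qed

section \<open>Gaussian wave functions\<close>

definition gauss :: "complex \<Rightarrow> complex \<Rightarrow> complex \<Rightarrow> wavefun" where
  "gauss w b c = (\<lambda>x. exp (- (w * (complex_of_real x)\<^sup>2) / 2 + b * complex_of_real x + c))"

text \<open>Polynomial prefactors make the family closed under d/dx and under multiplication by x.
  It also contains the time derivatives of all curves of Gaussians.\<close>

definition poly_gauss :: "complex poly \<Rightarrow> complex \<Rightarrow> complex \<Rightarrow> complex \<Rightarrow> wavefun" where
  "poly_gauss p w b c = (\<lambda>x. poly p (complex_of_real x) * gauss w b c x)"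

lemma gauss_eq_poly_gauss: "gauss w b c = poly_gauss 1 w b c"
  by (simp add: poly_gauss_def)

lemma cmod_gauss: "cmod (gauss w b c x) = exp (- (Re w * x\<^sup>2) / 2 + Re b * x + Re c)"
  by (simp add: gauss_def flip: of_real_power)

lemma gauss_add: "gauss (w + w') (b + b') (c + c') x = gauss w b c x * gauss w' b' c' x"
  by (simp add: gauss_def algebra_simps add_divide_distrib diff_divide_distrib flip: exp_add)

lemma has_vector_derivative_poly_gauss:
  "(poly_gauss p w b c has_vector_derivative
    poly_gauss (pderiv p + p * [:b, - w:]) w b c x) (at x)"
  unfolding poly_gauss_def gauss_def
  by (rule has_vector_derivative_real_field)
     (auto intro!: derivative_eq_intros simp: field_simps power2_eq_square)

lemma continuous_on_poly_gauss: "continuous_on A (poly_gauss p w b c)"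
  by (rule continuous_on_subset[OF _ subset_UNIV])
     (auto intro!: continuous_at_imp_continuous_on
       has_vector_derivative_continuous[OF has_vector_derivative_poly_gauss])

lemma borel_measurable_poly_gauss [measurable]: "poly_gauss p w b c \<in> borel_measurable borel"
  by (intro borel_measurable_continuous_onI continuous_on_poly_gauss)

lemma linear_le_quadratic:
  fixes a b x :: real
  assumes "a > 0"
  shows "b * x \<le> a * x\<^sup>2 + b\<^sup>2 / (4 * a)"
proof -
  have "0 \<le> (2 * a * x - b)\<^sup>2 / (4 * a)"
    using assms by simp
  also have "\<dots> = a * x\<^sup>2 + b\<^sup>2 / (4 * a) - b * x"
    using assms by (simp add: field_simps power2_eq_square)
  finally show ?thesis by simp
qed

text \<open>Each factor x is absorbed by half of the decay rate still available, which is why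
  \<open>w\<close> varies in the induction.\<close>

lemma bounded_poly_gauss:
  assumes "Re w > 0"
  shows "bounded (range (poly_gauss p w b c))"
  using assms
proof (induction p arbitrary: w)
  case 0
  then show ?case by (simp add: poly_gauss_def image_constant_conv)
next
  case (pCons a p)
  define v where "v = complex_of_real (Re w / 2)"
  have v: "Re v > 0" "Re (w - v) > 0" using pCons.prems by (simp_all add: v_def)
  have 1: "bounded (range (gauss w b c))"
    unfolding bounded_iff
  proof (intro exI ballI, clarify)
    fix x
    have "Re b * x \<le> Re w / 2 * x\<^sup>2 + (Re b)\<^sup>2 / (4 * (Re w / 2))"
      by (rule linear_le_quadratic) (use pCons.prems in simp)
    then show "cmod (gauss w b c x) \<le> exp ((Re b)\<^sup>2 / (4 * (Re w / 2)) + Re c)"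
      by (simp add: cmod_gauss)
  qed
  have 2: "bounded (range (\<lambda>x. complex_of_real x * gauss v 0 0 x))"
    unfolding bounded_iff
  proof (intro exI ballI, clarify)
    fix x
    have "\<bar>x\<bar> \<le> Re v / 2 * \<bar>x\<bar>\<^sup>2 + 1 / (4 * (Re v / 2))"
      using linear_le_quadratic[of "Re v / 2" 1 "\<bar>x\<bar>"] v by simp
    also have "\<dots> \<le> Re v * x\<^sup>2 / 2 + 1 + 1 / (4 * (Re v / 2))" by simp
    also have "Re v * x\<^sup>2 / 2 + 1 \<le> exp (Re v * x\<^sup>2 / 2)"
      by (subst add.commute) (rule exp_ge_add_one_self)
    also have "exp (Re v * x\<^sup>2 / 2) + 1 / (4 * (Re v / 2)) \<le>
        exp (Re v * x\<^sup>2 / 2) * (1 + 1 / (4 * (Re v / 2)))"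
      using v mult_right_mono[of 1 "exp (Re v * x\<^sup>2 / 2)" "1 / (4 * (Re v / 2))"]
      by (simp add: distrib_left)
    finally have "\<bar>x\<bar> \<le> exp (Re v * x\<^sup>2 / 2) * (1 + 1 / (4 * (Re v / 2)))" by simp
    then show "cmod (complex_of_real x * gauss v 0 0 x) \<le> 1 + 1 / (4 * (Re v / 2))"
      by (simp add: norm_mult cmod_gauss exp_minus field_simps)
  qed
  have "bounded (range (\<lambda>x. a * gauss w b c x +
      complex_of_real x * gauss v 0 0 x * poly_gauss p (w - v) b c x))"
    by (intro bounded_range_add bounded_range_cmult bounded_range_mult 1 2 pCons.IH v)
  also have "(\<lambda>x. a * gauss w b c x +
      complex_of_real x * gauss v 0 0 x * poly_gauss p (w - v) b c x) = poly_gauss (pCons a p) w b c"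
    using gauss_add[of v "w - v" 0 b 0 c]
    by (simp add: poly_gauss_def algebra_simps)
  finally show ?case .
qed

lemma poly_gauss_schwartz:
  assumes "Re w > 0"
  shows "poly_gauss p w b c \<in> schwartz"
proof -
  let ?D = "\<lambda>(g :: wavefun) y. vector_derivative g (at y)"
  have "\<exists>q. (?D ^^ k) (poly_gauss p w b c) = poly_gauss q w b c" for k
  proof (induction k)
    case (Suc k)
    then obtain q where "(?D ^^ k) (poly_gauss p w b c) = poly_gauss q w b c" by blast
    then have "(?D ^^ Suc k) (poly_gauss p w b c) = ?D (poly_gauss q w b c)" by simp
    also have "\<dots> = poly_gauss (pderiv q + q * [:b, - w:]) w b c"
      by (intro ext vector_derivative_at has_vector_derivative_poly_gauss)
    finally show ?case by blast
  qed auto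
  then obtain q where q: "\<And>k. (?D ^^ k) (poly_gauss p w b c) = poly_gauss (q k) w b c"
    by metis
  have "bounded (range (\<lambda>x. complex_of_real (x ^ m) * poly_gauss (q k) w b c x))" for m k
  proof -
    have "(\<lambda>x. complex_of_real (x ^ m) * poly_gauss (q k) w b c x) =
        poly_gauss (monom 1 m * q k) w b c"
      by (simp add: poly_gauss_def poly_monom mult.assoc)
    then show ?thesis
      by (simp only: bounded_poly_gauss[OF assms])
  qed
  then show ?thesis
    unfolding schwartz_def mem_Collect_eq q
    using differentiableI_vector[OF has_vector_derivative_poly_gauss] by auto
qed

lemma integrable_exp_neg_sq:
  assumes "a > 0"
  shows "integrable lborel (\<lambda>x::real. exp (- (a * x\<^sup>2)))"
proof -
  define \<sigma> where "\<sigma> = sqrt (1 / (2 * a))"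
  have \<sigma>: "2 * \<sigma>\<^sup>2 = 1 / a" "\<sigma> > 0" using assms by (simp_all add: \<sigma>_def)
  have "integrable lborel (\<lambda>x. sqrt (2 * pi * \<sigma>\<^sup>2) * normal_density 0 \<sigma> x)"
    by (intro integrable_mult_right integrable_normal_density) (use \<sigma> in simp)
  then show ?thesis
    using \<sigma> by (simp add: normal_density_def mult.commute)
qed

text \<open>Half of the decay keeps the polynomial part bounded; the square of the other half is an
  integrable Gaussian.\<close>

lemma poly_gauss_L2:
  assumes "Re w > 0"
  shows "poly_gauss p w b c \<in> L2"
proof -
  define v where "v = complex_of_real (Re w / 2)"
  have v: "Re v > 0" "Re (w - v) > 0" using assms by (simp_all add: v_def)
  obtain C where C: "\<And>x. cmod (poly_gauss p (w - v) b c x) \<le> C"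
    using bounded_poly_gauss[OF v(2), of p b c] by (auto simp: bounded_iff)
  show ?thesis
  proof (rule L2_bound)
    show "integrable lborel (\<lambda>x. C\<^sup>2 * exp (- (Re v * x\<^sup>2)))"
      using integrable_exp_neg_sq[OF v(1)] by simp
    fix x
    have "poly_gauss p w b c x = poly_gauss p (w - v) b c x * gauss v 0 0 x"
      using gauss_add[of v "w - v" 0 b 0 c x] by (simp add: poly_gauss_def mult_ac)
    then have "(cmod (poly_gauss p w b c x))\<^sup>2 =
        (cmod (poly_gauss p (w - v) b c x))\<^sup>2 * exp (- (Re v * x\<^sup>2))"
      by (simp add: norm_mult power_mult_distrib cmod_gauss flip: exp_double)
    also have "\<dots> \<le> C\<^sup>2 * exp (- (Re v * x\<^sup>2))"
      by (intro mult_right_mono power_mono C) auto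
    finally show "(cmod (poly_gauss p w b c x))\<^sup>2 \<le> C\<^sup>2 * exp (- (Re v * x\<^sup>2))" .
  qed simp
qed


section \<open>Gaussian solutions of the evolution equation\<close>

text \<open>The mean value inequality bounds all difference quotients near \<open>t\<close> by
  \<open>K\<close>, so dominated convergence lifts the pointwise time derivative to one in the
  norm.\<close>

lemma l2_derivative:
  fixes u v :: "real \<Rightarrow> wavefun"
  assumes "\<delta> > 0"
    and u: "\<And>s x. \<bar>s - t\<bar> < \<delta> \<Longrightarrow> ((\<lambda>s. u s x) has_vector_derivative v s x) (at s)"
    and K: "\<And>s x. \<bar>s - t\<bar> < \<delta> \<Longrightarrow> cmod (v s x) \<le> K x" "integrable lborel (\<lambda>x. (K x)\<^sup>2)"
    and meas [measurable]: "\<And>s. u s \<in> borel_measurable borel" "v t \<in> borel_measurable borel"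
  shows "((\<lambda>h. l2norm (\<lambda>x. (u (t + h) x - u t x) / complex_of_real h - v t x)) \<longlongrightarrow> 0) (at 0)"
proof -
  let ?q = "\<lambda>h x. (u (t + h) x - u t x) / complex_of_real h - v t x"
  have q0: "((\<lambda>h. cmod (?q h x)) \<longlongrightarrow> 0) (at 0)" for x
  proof -
    have "(\<lambda>h. norm (u (t + h) x - u t x - h *\<^sub>R v t x) / norm h) \<midarrow>0\<rightarrow> 0"
      using u[of t x] \<open>\<delta> > 0\<close> by (simp add: has_vector_derivative_def has_derivative_at)
    then show ?thesis
    proof (rule Lim_transform_eventually)
      show "\<forall>\<^sub>F h in at 0. norm (u (t + h) x - u t x - h *\<^sub>R v t x) / norm h = cmod (?q h x)"
        unfolding eventually_at_filter
      proof (intro always_eventually allI impI)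
        fix h :: real assume "h \<noteq> 0"
        then have "?q h x = (u (t + h) x - u t x - h *\<^sub>R v t x) / complex_of_real h"
          by (simp add: scaleR_conv_of_real diff_divide_distrib)
        then show "norm (u (t + h) x - u t x - h *\<^sub>R v t x) / norm h = cmod (?q h x)"
          by (simp add: norm_divide)
      qed
    qed
  qed
  have qK: "(cmod (?q h x))\<^sup>2 \<le> 4 * (K x)\<^sup>2" if h: "\<bar>h\<bar> < \<delta>" "h \<noteq> 0" for h x
  proof -
    have "norm (u (t + h) x - u t x) \<le> K x * norm (t + h - t)"
    proof (rule differentiable_bound[where S = "{t - \<delta> <..< t + \<delta>}" and f = "\<lambda>s. u s x"])
      fix s assume "s \<in> {t - \<delta> <..< t + \<delta>}"
      then have s: "\<bar>s - t\<bar> < \<delta>" by auto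
      show "((\<lambda>s. u s x) has_derivative (\<lambda>h. h *\<^sub>R v s x)) (at s within {t - \<delta> <..< t + \<delta>})"
        using u[OF s] has_derivative_at_withinI unfolding has_vector_derivative_def by blast
      show "onorm (\<lambda>h. h *\<^sub>R v s x) \<le> K x"
        by (rule onorm_le) (use K(1)[OF s, of x] in \<open>simp add: mult_left_mono mult.commute[of "K x"]\<close>)
    qed (use h \<open>\<delta> > 0\<close> in auto)
    then have "cmod ((u (t + h) x - u t x) / complex_of_real h) \<le> K x"
      using h by (simp add: norm_divide divide_simps mult.commute)
    then have "cmod (?q h x) \<le> K x + K x"
      using K(1)[of t x] \<open>\<delta> > 0\<close> by (intro order_trans[OF norm_triangle_ineq4] add_mono) auto
    then have "(cmod (?q h x))\<^sup>2 \<le> (2 * K x)\<^sup>2"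
      by (intro power_mono) auto
    then show ?thesis by (simp add: power_mult_distrib)
  qed
  have "((\<lambda>h. l2norm (?q h)) \<circ> X) \<longlonglongrightarrow> 0" if X: "\<And>i::nat. X i \<noteq> 0" "X \<longlonglongrightarrow> 0" for X
  proof -
    \<comment> \<open>The domination holds only for \<open>\<bar>h\<bar> < \<delta>\<close>, so the
      sequence is shifted until it stays in that range.\<close>
    obtain N where N: "\<And>n. n \<ge> N \<Longrightarrow> \<bar>X n\<bar> < \<delta>"
      using LIMSEQ_D[OF X(2) \<open>\<delta> > 0\<close>] by auto
    have X': "filterlim (\<lambda>n. X (n + N)) (at 0) sequentially"
      using X LIMSEQ_ignore_initial_segment[OF X(2), of N] by (simp add: filterlim_at)
    have "(\<lambda>n. LINT x|lborel. (cmod (?q (X (n + N)) x))\<^sup>2) \<longlonglongrightarrow> (LINT x|(lborel :: real measure). 0)"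
    proof (rule integral_dominated_convergence[where w = "\<lambda>x. 4 * (K x)\<^sup>2"])
      show "AE x in lborel. (\<lambda>n. (cmod (?q (X (n + N)) x))\<^sup>2) \<longlonglongrightarrow> 0"
        using filterlim_compose[OF q0 X'] by simp
      show "AE x in lborel. norm ((cmod (?q (X (n + N)) x))\<^sup>2) \<le> 4 * (K x)\<^sup>2" for n
        using qK X(1) N[of "n + N"] by simp
    qed (use K(2) in simp_all)
    from tendsto_real_sqrt[OF this] have "(\<lambda>n. l2norm (?q (X (n + N)))) \<longlonglongrightarrow> 0"
      by (simp add: l2norm_def)
    then show ?thesis
      unfolding comp_def by (rule LIMSEQ_offset)
  qed
  then show ?thesis
    by (simp add: tendsto_at_iff_sequentially)
qed

lemma gauss_curve_l2_derivative:
  fixes w b c w' b' c' :: "real \<Rightarrow> complex"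
  assumes d: "\<And>s. (w has_vector_derivative w' s) (at s)"
      "\<And>s. (b has_vector_derivative b' s) (at s)"
      "\<And>s. (c has_vector_derivative c' s) (at s)"
    and cont: "continuous_on UNIV w'" "continuous_on UNIV b'" "continuous_on UNIV c'"
    and pos: "\<And>s. Re (w s) > 0"
  defines "u \<equiv> \<lambda>s. gauss (w s) (b s) (c s)"
    and "v \<equiv> \<lambda>s. poly_gauss [:c' s, b' s, - w' s / 2:] (w s) (b s) (c s)"
  shows "((\<lambda>h. l2norm (\<lambda>x. (u (t + h) x - u t x) / complex_of_real h - v t x)) \<longlongrightarrow> 0) (at 0)"
proof -
  let ?S = "{t - 1..t + 1}"
  have cont': "continuous_on A w" "continuous_on A b" "continuous_on A c" for A
    using d by (meson continuous_at_imp_continuous_on has_vector_derivative_continuous)+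
  have bd: "\<exists>M. \<forall>s\<in>?S. cmod (g s) \<le> M" if "continuous_on UNIV g" for g
    using compact_imp_bounded[OF compact_continuous_image[OF continuous_on_subset[OF that], of ?S]]
    by (auto simp: bounded_iff)
  obtain M1 M2 M3 M4 M5 where M': "\<forall>s\<in>?S. cmod (w' s) \<le> M1" "\<forall>s\<in>?S. cmod (b' s) \<le> M2"
      "\<forall>s\<in>?S. cmod (c' s) \<le> M3" "\<forall>s\<in>?S. cmod (b s) \<le> M4" "\<forall>s\<in>?S. cmod (c s) \<le> M5"
    using bd[OF cont(1)] bd[OF cont(2)] bd[OF cont(3)] bd[OF cont'(2)] bd[OF cont'(3)] by blast
  define M where "M = \<bar>M1\<bar> + \<bar>M2\<bar> + \<bar>M3\<bar> + \<bar>M4\<bar> + \<bar>M5\<bar>"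
  have M: "cmod (w' s) \<le> M" "cmod (b' s) \<le> M" "cmod (c' s) \<le> M" "cmod (b s) \<le> M" "cmod (c s) \<le> M"
    if "s \<in> ?S" for s
    using M'[THEN bspec, OF that] by (simp_all add: M_def)
  have M0: "M \<ge> 0" by (simp add: M_def)
  obtain s0 where s0: "\<forall>s\<in>?S. Re (w s0) \<le> Re (w s)"
    using continuous_attains_inf[of ?S "\<lambda>s. Re (w s)"]
    by (auto intro!: continuous_intros cont')
  define a where "a = Re (w s0)"
  have a: "a > 0" using pos by (simp add: a_def)
  \<comment> \<open>Budget for the decay rate: the Gaussian offers at least a / 2. The linear term
    in the exponent costs a / 8 and the quadratic prefactor a / 4, which leaves a / 8 for the
    dominating function; \<open>C\<close> collects the constants of the two estimates.\<close>
  define C where "C = M * (2 * (1 + 4 / a)) * exp (2 * M\<^sup>2 / a + M)"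
  show ?thesis
  proof (rule l2_derivative[where \<delta> = 1 and K = "\<lambda>x. C * exp (- (a / 8 * x\<^sup>2))"])
    show "((\<lambda>s. u s x) has_vector_derivative v s x) (at s)" for s x
    proof -
      let ?x = "complex_of_real x"
      have "((\<lambda>s. - (?x\<^sup>2) / 2 * w s + ?x * b s + c s) has_vector_derivative
          - (?x\<^sup>2) / 2 * w' s + ?x * b' s + c' s) (at s)"
        by (intro has_vector_derivative_add has_vector_derivative_mult_right d)
      then have "((\<lambda>s. - (w s * ?x\<^sup>2) / 2 + b s * ?x + c s)
        has_vector_derivative poly [:c' s, b' s, - w' s / 2:] ?x) (at s)"
        by (simp add: power2_eq_square algebra_simps)
      from field_vector_diff_chain_at[OF this DERIV_exp]
      show ?thesis
        by (simp add: u_def v_def gauss_def poly_gauss_def comp_def)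
    qed
    show "integrable lborel (\<lambda>x. (C * exp (- (a / 8 * x\<^sup>2)))\<^sup>2)"
      using integrable_exp_neg_sq[of "a / 4"] a
      by (simp add: power_mult_distrib flip: exp_double)
    show "u s \<in> borel_measurable borel" "v t \<in> borel_measurable borel" for s
      by (simp_all add: u_def v_def gauss_eq_poly_gauss)
    show "cmod (v s x) \<le> C * exp (- (a / 8 * x\<^sup>2))" if "\<bar>s - t\<bar> < 1" for s x
    proof -
      have s: "s \<in> ?S" using that by auto
      let ?x = "complex_of_real x"
      have "cmod (poly [:c' s, b' s, - w' s / 2:] ?x) =
          cmod (c' s + b' s * ?x + (- w' s / 2) * ?x\<^sup>2)"
        by (simp add: power2_eq_square algebra_simps)
      also have "\<dots> \<le> cmod (c' s) + cmod (b' s) * \<bar>x\<bar> + cmod (w' s) / 2 * x\<^sup>2"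
        by (intro order_trans[OF norm_triangle_ineq] add_mono)
           (simp_all add: norm_mult norm_divide norm_power)
      also have "\<dots> \<le> M + M * \<bar>x\<bar> + M * x\<^sup>2"
        using M[OF s] M0 by (intro add_mono mult_right_mono) (simp_all, linarith?)
      also have "\<dots> = M * (1 + \<bar>x\<bar> + x\<^sup>2)" by (simp add: algebra_simps)
      also have "\<dots> \<le> M * ((2 * (1 + 4 / a)) * exp (a / 4 * x\<^sup>2))"
      proof (rule mult_left_mono[OF _ M0])
        have "\<bar>x\<bar> \<le> 1 + x\<^sup>2"
          using linear_le_quadratic[of 1 1 "\<bar>x\<bar>"] by simp
        then have "1 + \<bar>x\<bar> + x\<^sup>2 \<le> 2 * (1 + x\<^sup>2)" by simp
        also have "1 + x\<^sup>2 \<le> (1 + 4 / a) * (1 + a / 4 * x\<^sup>2)"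
          using a by (simp add: field_simps)
        also have "\<dots> \<le> (1 + 4 / a) * exp (a / 4 * x\<^sup>2)"
          using a by (intro mult_left_mono exp_ge_add_one_self) simp
        finally show "1 + \<bar>x\<bar> + x\<^sup>2 \<le> (2 * (1 + 4 / a)) * exp (a / 4 * x\<^sup>2)"
          by (simp only: mult.assoc)
      qed
      finally have p: "cmod (poly [:c' s, b' s, - w' s / 2:] ?x) \<le>
          M * ((2 * (1 + 4 / a)) * exp (a / 4 * x\<^sup>2))" .
      have "Re (b s) * x \<le> \<bar>Re (b s)\<bar> * \<bar>x\<bar>"
        by (metis abs_ge_self abs_mult)
      also have "\<dots> \<le> M * \<bar>x\<bar>"
        using M(4)[OF s] abs_Re_le_cmod[of "b s"] by (intro mult_right_mono) auto
      also have "\<dots> \<le> a / 8 * x\<^sup>2 + 2 * M\<^sup>2 / a"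
        using linear_le_quadratic[of "a / 8" M "\<bar>x\<bar>"] a by simp
      finally have "Re (b s) * x \<le> a / 8 * x\<^sup>2 + 2 * M\<^sup>2 / a" .
      moreover have "a * x\<^sup>2 \<le> Re (w s) * x\<^sup>2"
        using s0 s by (intro mult_right_mono) (auto simp: a_def)
      moreover have "Re (c s) \<le> M"
        using M(5)[OF s] complex_Re_le_cmod[of "c s"] by simp
      ultimately have g: "cmod (gauss (w s) (b s) (c s) x) \<le> exp (2 * M\<^sup>2 / a + M - 3 * a / 8 * x\<^sup>2)"
        by (simp add: cmod_gauss)
      have "cmod (v s x) \<le> (M * ((2 * (1 + 4 / a)) * exp (a / 4 * x\<^sup>2))) *
          exp (2 * M\<^sup>2 / a + M - 3 * a / 8 * x\<^sup>2)"
        unfolding v_def poly_gauss_def norm_mult using p g M0 a by (intro mult_mono) auto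
      also have "\<dots> = M * (2 * (1 + 4 / a)) *
          (exp (a / 4 * x\<^sup>2) * exp (2 * M\<^sup>2 / a + M - 3 * a / 8 * x\<^sup>2))"
        by (simp only: mult.assoc)
      also have "exp (a / 4 * x\<^sup>2) * exp (2 * M\<^sup>2 / a + M - 3 * a / 8 * x\<^sup>2) =
          exp (2 * M\<^sup>2 / a + M) * exp (- (a / 8 * x\<^sup>2))"
        unfolding exp_add[symmetric] by (rule arg_cong[where f=exp]) (simp add: algebra_simps)
      finally show ?thesis by (simp only: C_def mult.assoc)
    qed
  qed simp
qed

text \<open>The polynomial \<open>[:c', b', - w' / 2:]\<close> is the time derivative of the
  exponent, so \<open>G\<close> says that the curve solves the evolution equation pointwise. The
  decay condition is required at all times because \<open>flow_graph\<close> asks for solutions on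
  the whole real line.\<close>

lemma gauss_flow:
  fixes w b c w' b' c' :: "real \<Rightarrow> complex"
  assumes d: "\<And>s. (w has_vector_derivative w' s) (at s)"
      "\<And>s. (b has_vector_derivative b' s) (at s)"
      "\<And>s. (c has_vector_derivative c' s) (at s)"
    and cont: "continuous_on UNIV w'" "continuous_on UNIV b'" "continuous_on UNIV c'"
    and pos: "\<And>s. Re (w s) > 0"
    and G: "\<And>s. (gauss (w s) (b s) (c s),
        poly_gauss [:c' s, b' s, - w' s / 2:] (w s) (b s) (c s)) \<in> G"
  shows "(gauss (w 0) (b 0) (c 0), gauss (w 1) (b 1) (c 1)) \<in> flow_graph (l2_closure G)"
proof -
  have "(f, g) \<in> l2_closure G" if "f \<in> L2" "g \<in> L2" "(f, g) \<in> G" for f g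
  proof -
    have "\<forall>\<epsilon>>0. (f, g) \<in> G \<and> f \<in> L2 \<and> g \<in> L2 \<and>
        l2norm (\<lambda>x. f x - f x) < \<epsilon> \<and> l2norm (\<lambda>x. g x - g x) < \<epsilon>"
      using that by (simp add: l2norm_def)
    then show ?thesis
      unfolding l2_closure_def using that(1,2) by blast
  qed
  then have "(gauss (w s) (b s) (c s), poly_gauss [:c' s, b' s, - w' s / 2:] (w s) (b s) (c s))
      \<in> l2_closure G" for s
    using G pos by (metis gauss_eq_poly_gauss poly_gauss_L2)
  then show ?thesis
    using gauss_curve_l2_derivative[OF d cont pos] unfolding flow_graph_def
    by (intro CollectI case_prodI exI[of _ "\<lambda>s. gauss (w s) (b s) (c s)"]
        exI[of _ "\<lambda>s. poly_gauss [:c' s, b' s, - w' s / 2:] (w s) (b s) (c s)"] conjI allI) simp_all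
qed

lemma gauss_derivatives:
  "(gauss w b c has_vector_derivative (b - w * complex_of_real x) * gauss w b c x) (at x)"
  "((\<lambda>x. (b - w * complex_of_real x) * gauss w b c x) has_vector_derivative
     ((b - w * complex_of_real x)\<^sup>2 - w) * gauss w b c x) (at x)"
  using has_vector_derivative_poly_gauss[of 1 w b c x]
    has_vector_derivative_poly_gauss[of "[:b, - w:]" w b c x]
  by (simp_all add: gauss_eq_poly_gauss[symmetric] poly_gauss_def pderiv_pCons algebra_simps
      power2_eq_square)

text \<open>Comparing coefficients of powers of x gives the equations for \<open>b\<close> and
  \<open>c\<close>, with \<open>w\<close> constant. The unsimplified \<open>- 0 / 2\<close> matches
  the pattern of \<open>gauss_flow\<close> for \<open>w' = 0\<close>.\<close>

lemma gauss_displacement_generator: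
  assumes "Re w > 0"
    and b': "b' = (\<alpha> * (1 + w) - cnj \<alpha> * (1 - w)) / complex_of_real (sqrt 2)"
    and c': "c' = - (\<alpha> + cnj \<alpha>) * b / complex_of_real (sqrt 2)"
  shows "(gauss w b c, poly_gauss [:c', b', - 0 / 2:] w b c) \<in> displacement_generator \<alpha>"
proof -
  define r where "r = inverse (complex_of_real (sqrt 2))"
  have r: "z / complex_of_real (sqrt 2) = r * z" for z
    by (simp add: r_def field_simps)
  have "(\<lambda>x. \<alpha> * creation (gauss w b c) x - cnj \<alpha> * annihilation (gauss w b c) x) =
      poly_gauss [:c', b', - 0 / 2:] w b c"
    unfolding displacement_generator_eq[OF gauss_derivatives] poly_gauss_def b' c'
    by (simp add: r algebra_simps)
  then show ?thesis
    using poly_gauss_schwartz[OF assms(1)]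
    by (simp add: displacement_generator_def gauss_eq_poly_gauss)
qed

text \<open>The coefficient of x^2 is a Riccati equation for \<open>w\<close>; the constant one then
  determines \<open>c\<close> by integration.\<close>

lemma gauss_squeezing_generator:
  assumes "Re w > 0"
    and w': "w' = (2 * w * (cnj \<zeta> + \<zeta>) - (cnj \<zeta> - \<zeta>) * (1 + w\<^sup>2)) / 2"
    and c': "c' = (cnj \<zeta> + \<zeta> - (cnj \<zeta> - \<zeta>) * w) / 4"
  shows "(gauss w 0 c, poly_gauss [:c', 0, - w' / 2:] w 0 c) \<in> squeezing_generator \<zeta>"
proof -
  have "(\<lambda>x. (cnj \<zeta> * annihilation (annihilation (gauss w 0 c)) x -
      \<zeta> * creation (creation (gauss w 0 c)) x) / 2) = poly_gauss [:c', 0, - w' / 2:] w 0 c"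
    unfolding squeezing_generator_eq[OF gauss_derivatives] poly_gauss_def w' c'
    by (rule ext) (simp add: field_simps power2_eq_square)
  then show ?thesis
    using poly_gauss_schwartz[OF assms(1)]
    by (simp add: squeezing_generator_def gauss_eq_poly_gauss)
qed

section \<open>Identification of the squeezed and displaced vacuum\<close>

lemma vacuum_eq_gauss: "vacuum = gauss 1 0 (complex_of_real (- (ln pi / 4)))"
proof
  fix x
  have "pi powr (- 1 / 4) * exp (- x\<^sup>2 / 2) = exp (- (ln pi / 4) + - x\<^sup>2 / 2)"
    unfolding exp_add by (simp add: powr_def)
  then have "vacuum x = exp (complex_of_real (- (ln pi / 4) + - x\<^sup>2 / 2))"
    unfolding exp_of_real vacuum_def by simp
  then show "vacuum x = gauss 1 0 (complex_of_real (- (ln pi / 4))) x"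
    by (simp add: gauss_def algebra_simps)
qed

lemma squeezing_vacuum:
  obtains w c where "Re w > 0" "exp (2 * Re c) = sqrt (Re w / pi)"
    "squeezing \<zeta> vacuum \<in> L2" "AE x in lborel. squeezing \<zeta> vacuum x = gauss w 0 c x"
    "w = 1 \<Longrightarrow> \<zeta> = 0"
proof -
  \<comment> \<open>The exponent \<open>W\<close> solves a Riccati equation; its numerator and denominator \<open>B\<close>, \<open>N\<close> solve the
    associated linear system.\<close>
  define r where "r = cmod \<zeta>"
  \<comment> \<open>The phase of \<zeta>, with the default value 0 at \<zeta> = 0; there
    \<open>r = 0\<close> too, so \<open>N\<close> and \<open>B\<close> are constantly 1.\<close>
  define e where "e = sgn \<zeta>"
  define c0 where "c0 = complex_of_real (- (ln pi / 4))"
  define R where "R = complex_of_real r"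
  define N where "N = (\<lambda>z. cosh (R * z) - e * sinh (R * z))"
  define B where "B = (\<lambda>z. cosh (R * z) + e * sinh (R * z))"
  define N' where "N' = (\<lambda>z. R * (sinh (R * z) - e * cosh (R * z)))"
  define B' where "B' = (\<lambda>z. R * (sinh (R * z) + e * cosh (R * z)))"
  define W where "W = (\<lambda>s::real. B (of_real s) / N (of_real s))"
  define W' where "W' = (\<lambda>s::real. (B' (of_real s) * N (of_real s) - B (of_real s) * N' (of_real s)) /
      (N (of_real s) * N (of_real s)))"
  \<comment> \<open>The equation for the constant term integrates to - (ln N) / 2. Through Re W = 1
    / |N|^2 this same term yields the normalisation of the final state.\<close>
  define K where "K = (\<lambda>s::real. c0 - Ln (N (of_real s)) / 2)"
  define K' where "K' = (\<lambda>s::real. - (N' (of_real s) / N (of_real s) / 2))"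
  have \<zeta>: "\<zeta> = R * e" "cnj \<zeta> * e = R"
  proof -
    show "\<zeta> = R * e" by (cases "\<zeta> = 0") (simp_all add: R_def r_def e_def sgn_eq)
    show "cnj \<zeta> * e = R"
      using complex_norm_square[of \<zeta>]
      by (cases "\<zeta> = 0") (simp_all add: R_def r_def e_def sgn_eq field_simps power2_eq_square)
  qed
  have e1: "cmod e \<le> 1" by (simp add: e_def norm_sgn)
  have "cosh (complex_of_real x) = complex_of_real (cosh x)"
    "sinh (complex_of_real x) = complex_of_real (sinh x)" for x
    by (simp_all add: cosh_def sinh_def scaleR_conv_of_real flip: exp_of_real)
  note hyp_of_real = this
  have N_of_real: "N (of_real s) = of_real (cosh (r * s)) - e * of_real (sinh (r * s))"
    and B_of_real: "B (of_real s) = of_real (cosh (r * s)) + e * of_real (sinh (r * s))" for s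
    by (simp_all add: N_def B_def R_def hyp_of_real flip: of_real_mult)
  \<comment> \<open>Since |Re e| \<le> 1 and |sinh| < cosh. Beyond \<open>N \<noteq> 0\<close>, this
    keeps \<open>N\<close> off the branch cut of \<open>Ln\<close>.\<close>
  have ReN: "Re (N (of_real s)) > 0" for s
  proof -
    have "Re e * sinh (r * s) \<le> \<bar>Re e\<bar> * \<bar>sinh (r * s)\<bar>" by (metis abs_ge_self abs_mult)
    also have "\<dots> \<le> 1 * \<bar>sinh (r * s)\<bar>"
      using e1 abs_Re_le_cmod[of e] by (intro mult_right_mono) auto
    also have "\<dots> < cosh (r * s)"
      using cosh_square_eq[of "r * s"] by (intro power2_less_imp_less[of _ "cosh (r * s)"]) (auto simp: power2_abs)
    finally show ?thesis by (simp add: N_of_real)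
  qed
  have N0: "N (of_real s) \<noteq> 0" for s using ReN[of s] by auto
  have CS: "cosh z * cosh z - sinh z * sinh z = 1" for z :: complex
    using cosh_square_eq[of z] by (simp add: power2_eq_square)
  \<comment> \<open>The numerator Re (B cnj N) is cosh^2 - |e|^2 sinh^2, which is 1 when |e| = 1,
    and also when s = 0.\<close>
  have ReW: "Re (W s) = 1 / (cmod (N (of_real s)))\<^sup>2" if "\<zeta> \<noteq> 0 \<or> s = 0" for s
  proof -
    let ?C = "cosh (r * s)" and ?S = "sinh (r * s)"
    have ee: "(Re e)\<^sup>2 + (Im e)\<^sup>2 = 1 \<or> s = 0"
      using that cmod_power2[of e] norm_sgn[of \<zeta>] by (auto simp: e_def)
    have "Re (B (of_real s) * cnj (N (of_real s))) = ?C\<^sup>2 - ((Re e)\<^sup>2 + (Im e)\<^sup>2) * ?S\<^sup>2"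
      by (simp add: N_of_real B_of_real power2_eq_square algebra_simps)
    also have "\<dots> = 1" using ee cosh_square_eq[of "r * s"] by auto
    finally have *: "Re (B (of_real s) * cnj (N (of_real s))) = 1" .
    have "W s = (B (of_real s) * cnj (N (of_real s))) / complex_of_real ((cmod (N (of_real s)))\<^sup>2)"
      using N0[of s] complex_norm_square[of "N (of_real s)"] by (simp add: W_def)
    with * show ?thesis by (simp only: Re_divide_of_real)
  qed
  have ReW': "Re (W s) = 1 / (cmod (N (of_real s)))\<^sup>2" for s
  proof (cases "\<zeta> = 0")
    case True
    then show ?thesis by (simp add: W_def N_def B_def R_def r_def)
  qed (use ReW in auto)
  have W_pos: "Re (W s) > 0" for s
    using N0[of s] by (simp add: ReW')
  have dN: "(N has_field_derivative N' z) (at z)" and dB: "(B has_field_derivative B' z) (at z)" for z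
    unfolding N_def N'_def B_def B'_def
    by (auto intro!: derivative_eq_intros simp: algebra_simps)
  have dW: "(W has_vector_derivative W' s) (at s)" for s
    unfolding W_def W'_def
    by (rule has_vector_derivative_real_field[where f = "\<lambda>z. B z / N z"])
       (rule DERIV_divide dB dN N0)+
  have dK: "(K has_vector_derivative K' s) (at s)" for s
  proof -
    have "((\<lambda>z. c0 - Ln (N z) / 2) has_field_derivative K' s) (at (of_real s))"
    proof -
      have "N (of_real s) \<notin> \<real>\<^sub>\<le>\<^sub>0"
        using ReN[of s] by (simp add: complex_nonpos_Reals_iff)
      then have "((\<lambda>z. Ln (N z)) has_field_derivative inverse (N (of_real s)) * N' (of_real s)) (at (of_real s))"
        by (intro DERIV_chain2[OF has_field_derivative_Ln dN])
      then have *: "((\<lambda>z. c0 - Ln (N z) / 2) has_field_derivative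
          0 - inverse (N (of_real s)) * N' (of_real s) / 2) (at (of_real s))"
        by (intro DERIV_diff DERIV_const DERIV_cdivide)
      have eq: "0 - inverse n * n' / 2 = - (n' / n / 2)" for n n' :: complex
        by (simp add: inverse_eq_divide)
      have "K' s = 0 - inverse (N (of_real s)) * N' (of_real s) / 2"
        unfolding K'_def by (rule eq[symmetric])
      from *[folded this] show ?thesis .
    qed
    then show ?thesis
      unfolding K_def by (rule has_vector_derivative_real_field)
  qed
  have cont: "continuous_on UNIV W'" "continuous_on UNIV K'"
    unfolding W'_def K'_def N_def B_def N'_def B'_def
    using N0[unfolded N_def] by (auto intro!: continuous_intros)
  have "(gauss (W s) 0 (K s), poly_gauss [:K' s, 0, - W' s / 2:] (W s) 0 (K s)) \<in> squeezing_generator \<zeta>" for s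
  proof (rule gauss_squeezing_generator[OF W_pos])
    define n where "n = N (of_real s)"
    define b where "b = B (of_real s)"
    define C where "C = cosh (R * of_real s)"
    define S where "S = sinh (R * of_real s)"
    \<comment> \<open>Naming the conjugate turns both differential equations into polynomial
      identities modulo \<open>rel\<close>, within reach of \<open>algebra\<close>.\<close>
    define zb where "zb = cnj \<zeta>"
    have nb: "n = C - e * S" "b = C + e * S" "N' (of_real s) = R * (S - e * C)" "B' (of_real s) = R * (S + e * C)"
      by (simp_all add: n_def b_def C_def S_def N_def B_def N'_def B'_def)
    have n0: "n \<noteq> 0" using N0 by (simp add: n_def)
    have rel: "C * C - S * S = 1" "\<zeta> = R * e" "zb * e = R"
      using CS \<zeta> by (simp_all add: C_def S_def zb_def)
    have W: "W s = b / n" by (simp add: W_def n_def b_def)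
    have "2 * (B' (of_real s) * n - b * N' (of_real s)) = 2 * b * n * (zb + \<zeta>) - (zb - \<zeta>) * (n * n + b * b)"
      unfolding nb using rel by algebra
    then have "2 * W' s = 2 * (b / n) * (zb + \<zeta>) - (zb - \<zeta>) * (1 + (b / n)\<^sup>2)"
      using n0 unfolding W'_def n_def[symmetric] b_def[symmetric]
      by (simp add: power2_eq_square divide_simps)
    then show "W' s = (2 * W s * (cnj \<zeta> + \<zeta>) - (cnj \<zeta> - \<zeta>) * (1 + (W s)\<^sup>2)) / 2"
      by (simp add: W zb_def mult.commute[of "W' s"])
    have "- 2 * N' (of_real s) = (zb + \<zeta>) * n - (zb - \<zeta>) * b"
      unfolding nb using rel by algebra
    then have "4 * K' s = zb + \<zeta> - (zb - \<zeta>) * (b / n)"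
      using n0 unfolding K'_def n_def[symmetric]
      by (simp add: divide_simps)
    then show "K' s = (cnj \<zeta> + \<zeta> - (cnj \<zeta> - \<zeta>) * W s) / 4"
      by (simp add: W zb_def mult.commute[of "K' s"])
  qed
  from gauss_flow[where b = "\<lambda>s. 0" and b' = "\<lambda>s. 0", OF dW _ dK cont(1) _ cont(2) W_pos this]
  have flow: "(gauss (W 0) 0 (K 0), gauss (W 1) 0 (K 1)) \<in> flow_graph (l2_closure (squeezing_generator \<zeta>))"
    by simp
  have vac: "vacuum = gauss (W 0) 0 (K 0)"
    by (simp add: vacuum_eq_gauss W_def K_def N_def B_def c0_def)
  have "vacuum \<in> L2"
    unfolding vac gauss_eq_poly_gauss by (rule poly_gauss_L2[OF W_pos])
  with vac have *: "squeezing \<zeta> vacuum \<in> L2 \<and> (AE x in lborel. squeezing \<zeta> vacuum x = gauss (W 1) 0 (K 1) x)"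
    using exp_op_eq_AE[OF skew_symmetric_squeezing flow, of vacuum]
    by (simp add: squeezing_def squeezing_generator_def)
  have "2 * Re (K 1) = - (ln pi / 2) - ln (cmod (N 1))"
    using N0[of 1] by (simp add: K_def c0_def)
  also have "\<dots> = ln (sqrt (Re (W 1) / pi))"
    using N0[of 1] by (simp add: ReW' ln_sqrt ln_div ln_mult ln_realpow)
  finally have "exp (2 * Re (K 1)) = sqrt (Re (W 1) / pi)"
    using W_pos[of 1] by simp
  moreover have "\<zeta> = 0" if "W 1 = 1"
  proof -
    have "B (of_real 1) = N (of_real 1)" using that N0[of 1] by (simp add: W_def)
    then have "e = 0 \<or> sinh r = 0"
      by (simp add: B_of_real N_of_real del: of_real_1)
    then show ?thesis
      by (auto simp: e_def r_def sgn_eq_0_iff)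
  qed
  ultimately show ?thesis
    using that[of "W 1" "K 1"] W_pos * by blast
qed

text \<open>The linear coefficient grows at the constant rate \<open>\<beta>\<close>, so the
  constant term is quadratic in time; the last division by 2 in \<open>\<gamma>\<close> is the
  integral of s over [0, 1]. The premise on \<open>\<psi>\<close> is almost everywhere equality
  because that is all that is known of a squeezed vacuum.\<close>

lemma displacement_gauss:
  fixes \<alpha> w c :: complex
  assumes "Re w > 0" and \<psi>: "\<psi> \<in> L2" "AE x in lborel. \<psi> x = gauss w 0 c x"
  defines "\<beta> \<equiv> (\<alpha> * (1 + w) - cnj \<alpha> * (1 - w)) / complex_of_real (sqrt 2)"
  defines "\<gamma> \<equiv> c - (\<alpha> + cnj \<alpha>) * \<beta> / complex_of_real (sqrt 2) / 2"
  shows "displacement \<alpha> \<psi> \<in> L2 \<and> (AE x in lborel. displacement \<alpha> \<psi> x = gauss w \<beta> \<gamma> x)"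
proof -
  define r where "r = inverse (complex_of_real (sqrt 2))"
  have r: "z / complex_of_real (sqrt 2) = r * z" for z
    by (simp add: r_def field_simps)
  define k where "k = (\<alpha> + cnj \<alpha>) * \<beta> / complex_of_real (sqrt 2)"
  define b where "b = (\<lambda>s. complex_of_real s * \<beta>)"
  define C where "C = (\<lambda>s::real. c - k * (of_real s)\<^sup>2 / 2)"
  define C' where "C' = (\<lambda>s::real. - (k * of_real s))"
  have 1: "(b has_vector_derivative \<beta>) (at s)" "(C has_vector_derivative C' s) (at s)" for s
    unfolding b_def C_def C'_def
    by (auto intro!: has_vector_derivative_real_field derivative_eq_intros)
  have 2: "continuous_on UNIV C'" unfolding C'_def by (intro continuous_intros)
  have "(gauss w (b s) (C s), poly_gauss [:C' s, \<beta>, - 0 / 2:] w (b s) (C s)) \<in> displacement_generator \<alpha>" for s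
    by (rule gauss_displacement_generator[OF assms(1) \<beta>_def[THEN meta_eq_to_obj_eq]])
       (simp add: C'_def k_def b_def r algebra_simps)
  from gauss_flow[where w = "\<lambda>s. w" and w' = "\<lambda>s. 0" and b' = "\<lambda>s. \<beta>", OF _ 1 _ _ 2 assms(1) this]
  have "(gauss w (b 0) (C 0), gauss w (b 1) (C 1)) \<in> flow_graph (l2_closure (displacement_generator \<alpha>))"
    by simp
  then have "(gauss w 0 c, gauss w \<beta> \<gamma>) \<in> flow_graph (l2_closure (displacement_generator \<alpha>))"
    by (simp add: b_def C_def \<gamma>_def k_def)
  from exp_op_eq_AE[OF skew_symmetric_displacement this \<psi>] show ?thesis
    by (simp add: displacement_def displacement_generator_def)
qed


section \<open>Wigner functions of Gaussian states\<close>

text \<open>For fixed q the maps y to q - y and y to q + y pull null sets back to null sets, so the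
  Wigner functions agree at every point, not just almost everywhere.\<close>

lemma wigner_cong_AE:
  assumes "\<psi> \<in> borel_measurable borel" "\<phi> \<in> borel_measurable borel"
    and AE: "AE x in lborel. \<psi> x = \<phi> x"
  shows "wigner \<psi> = wigner \<phi>"
proof -
  note [measurable] = assms(1,2)
  have cnj [measurable]: "cnj \<in> borel_measurable borel"
    by (intro borel_measurable_continuous_onI continuous_intros)
  have ex [measurable]: "(\<lambda>y::real. exp (2 * \<i> * complex_of_real (p * y))) \<in> borel_measurable borel" for p
    by (intro borel_measurable_continuous_onI continuous_intros)
  have "(LINT y|lborel. exp (2 * \<i> * complex_of_real (p * y)) * (\<psi> (q - y) * cnj (\<psi> (q + y)))) =
      (LINT y|lborel. exp (2 * \<i> * complex_of_real (p * y)) * (\<phi> (q - y) * cnj (\<phi> (q + y))))" for p q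
  proof (rule integral_cong_AE)
    have "AE y in lborel. \<psi> (q + (- 1) * y) = \<phi> (q + (- 1) * y)"
      "AE y in lborel. \<psi> (q + 1 * y) = \<phi> (q + 1 * y)"
      by (rule AE_borel_affine[where P = "\<lambda>x. \<psi> x = \<phi> x", OF _ _ AE]; measurable)+
    then show "AE y in lborel. exp (2 * \<i> * complex_of_real (p * y)) * (\<psi> (q - y) * cnj (\<psi> (q + y))) =
        exp (2 * \<i> * complex_of_real (p * y)) * (\<phi> (q - y) * cnj (\<phi> (q + y)))"
      by eventually_elim simp
  qed measurable
  then show ?thesis by (simp add: wigner_def)
qed

text \<open>A rescaled characteristic function of the standard normal distribution: x = d y turns
  its density into exp (- a y^2) and \<open>t = 2 * k / d\<close> gives the wanted
  frequency.\<close>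

lemma integral_gauss_cis:
  assumes "a > 0"
  shows "(LINT y|lborel. complex_of_real (exp (- (a * y\<^sup>2))) * iexp (2 * k * y)) =
    complex_of_real (sqrt (pi / a) * exp (- (k\<^sup>2 / a)))"
proof -
  define d where "d = sqrt (2 * a)"
  have d: "d > 0" "d * d = 2 * a" using assms by (simp_all add: d_def)
  define t where "t = 2 * k / d"
  have "complex_of_real (exp (- (t\<^sup>2) / 2)) = (LINT x|std_normal_distribution. iexp (t * x))"
    using fun_cong[OF char_std_normal_distribution, of t] by (simp add: char_def)
  also have "\<dots> = (LINT x|lborel. std_normal_density x *\<^sub>R iexp (t * x))"
    by (subst integral_density) (auto intro!: borel_measurable_continuous_onI continuous_intros)
  also have "\<dots> = \<bar>d\<bar> *\<^sub>R (LINT y|lborel. std_normal_density (0 + d * y) *\<^sub>R iexp (t * (0 + d * y)))"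
    using d by (intro lborel_integral_real_affine) simp
  also have "(\<lambda>y. std_normal_density (0 + d * y) *\<^sub>R iexp (t * (0 + d * y))) =
      (\<lambda>y. complex_of_real (1 / sqrt (2 * pi)) * (complex_of_real (exp (- (a * y\<^sup>2))) * iexp (2 * k * y)))"
  proof
    fix y
    have 1: "std_normal_density (0 + d * y) = 1 / sqrt (2 * pi) * exp (- (a * y\<^sup>2))"
      using d by (simp add: std_normal_density_def power2_eq_square)
    have 2: "t * (0 + d * y) = 2 * k * y"
      using d by (simp add: t_def)
    show "std_normal_density (0 + d * y) *\<^sub>R iexp (t * (0 + d * y)) =
       complex_of_real (1 / sqrt (2 * pi)) * (complex_of_real (exp (- (a * y\<^sup>2))) * iexp (2 * k * y))"
      unfolding 1 2 by (simp add: scaleR_conv_of_real)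
  qed
  finally have *: "complex_of_real (exp (- (t\<^sup>2) / 2)) = complex_of_real (d / sqrt (2 * pi)) *
      (LINT y|lborel. complex_of_real (exp (- (a * y\<^sup>2))) * iexp (2 * k * y))"
    (is "_ = _ * ?J")
    using d by (simp add: scaleR_conv_of_real)
  have t: "- (t\<^sup>2) / 2 = - (k\<^sup>2 / a)"
    using d by (simp add: t_def power2_eq_square field_simps)
  have "d / sqrt (2 * pi) = 1 / sqrt (pi / a)"
    using assms by (simp add: d_def real_sqrt_mult real_sqrt_divide)
  then have "complex_of_real (sqrt (pi / a)) * complex_of_real (exp (- (k\<^sup>2 / a))) =
      complex_of_real (sqrt (pi / a) * (1 / sqrt (pi / a))) * ?J"
    using * unfolding t by (simp only: of_real_mult mult.assoc)
  then show ?thesis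
    using assms by simp
qed

text \<open>Here a + i s is the coefficient w of the wave function. The quadratic form has the
  matrix with rows (a + s^2 / a, s / a) and (s / a, 1 / a), of determinant 1.\<close>

definition gauss_wigner :: "real \<Rightarrow> real \<Rightarrow> real \<times> real \<Rightarrow> real \<times> real \<Rightarrow> real" where
  "gauss_wigner a s = (\<lambda>(q0, p0) (q, p).
     exp (- (a * (q - q0)\<^sup>2 + (p - p0 + s * (q - q0))\<^sup>2 / a)) / pi)"

text \<open>The condition on \<open>b\<close> says that the state is centred at (q0, p0), the one on
  \<open>c\<close> that it has norm 1. The oscillating factors combine to the frequency k = p - p0 +
  s (q - q0), and the Fourier integral adds k^2 / a to the exponent.\<close>

lemma wigner_gauss:
  assumes a: "Re w > 0"
    and b: "b = w * complex_of_real q0 + \<i> * complex_of_real p0"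
    and c: "exp (2 * Re c) = sqrt (Re w / pi) * exp (- (Re w * q0\<^sup>2))"
  shows "wigner (gauss w b c) = gauss_wigner (Re w) (Im w) (q0, p0)"
proof
  fix r :: "real \<times> real"
  obtain q p where r: "r = (q, p)" by (cases r)
  define a where "a = Re w"
  define s where "s = Im w"
  define k where "k = p - p0 + s * (q - q0)"
  have w: "w = complex_of_real a + \<i> * complex_of_real s"
    by (simp add: a_def s_def complex_eq_iff)
  define E where "E = exp (2 * Re c - a * q\<^sup>2 + 2 * a * q0 * q)"
  have "exp (2 * \<i> * complex_of_real (p * y)) * (gauss w b c (q - y) * cnj (gauss w b c (q + y))) =
      complex_of_real E * (complex_of_real (exp (- (a * y\<^sup>2))) * iexp (2 * k * y))" for y
  proof -
    have c: "c = complex_of_real (Re c) + \<i> * complex_of_real (Im c)" by (rule complex_eq)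
    have "exp (2 * \<i> * complex_of_real (p * y)) * (gauss w b c (q - y) * cnj (gauss w b c (q + y))) =
       exp (complex_of_real (2 * Re c - a * q\<^sup>2 + 2 * a * q0 * q) +
         (complex_of_real (- (a * y\<^sup>2)) + \<i> * complex_of_real (2 * k * y)))"
      unfolding gauss_def exp_cnj exp_add[symmetric]
      by (rule arg_cong[where f = exp])
         (simp add: b w k_def complex_eq_iff power2_eq_square field_simps)
    also have "\<dots> = complex_of_real E * (complex_of_real (exp (- (a * y\<^sup>2))) * iexp (2 * k * y))"
      by (simp only: exp_add exp_of_real E_def)
    finally show ?thesis .
  qed
  then have "wigner (gauss w b c) r = E * (sqrt (pi / a) * exp (- (k\<^sup>2 / a))) / pi"
    using assms(1) by (simp add: wigner_def r integral_gauss_cis a_def del: of_real_mult flip: of_real_mult)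
  also have "E * sqrt (pi / a) = exp (- (a * (q - q0)\<^sup>2))"
  proof -
    have "E = exp (2 * Re c) * exp (- a * q\<^sup>2 + 2 * a * q0 * q)"
      by (simp add: E_def flip: exp_add)
    also have "\<dots> * sqrt (pi / a) = (sqrt (a / pi) * sqrt (pi / a)) *
        (exp (- (a * q0\<^sup>2)) * exp (- a * q\<^sup>2 + 2 * a * q0 * q))"
      unfolding c a_def by (simp only: mult_ac)
    also have "sqrt (a / pi) * sqrt (pi / a) = 1"
      using assms(1) by (simp add: a_def flip: real_sqrt_mult)
    also have "exp (- (a * q0\<^sup>2)) * exp (- a * q\<^sup>2 + 2 * a * q0 * q) = exp (- (a * (q - q0)\<^sup>2))"
      unfolding exp_add[symmetric]
      by (rule arg_cong[where f = exp]) (simp add: power2_eq_square algebra_simps)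
    finally show ?thesis by simp
  qed
  then have "E * (sqrt (pi / a) * exp (- (k\<^sup>2 / a))) / pi = exp (- (a * (q - q0)\<^sup>2)) * exp (- (k\<^sup>2 / a)) / pi"
    by (simp flip: mult.assoc)
  finally show "wigner (gauss w b c) r = gauss_wigner (Re w) (Im w) (q0, p0) r"
    by (simp add: gauss_wigner_def r k_def a_def s_def flip: exp_add)
qed

lemma wigner_vacuum: "wigner vacuum = gauss_wigner 1 0 (0, 0)"
proof -
  have "2 * Re (complex_of_real (- (ln pi / 4))) = ln (sqrt (1 / pi))"
    by (simp add: ln_sqrt ln_div)
  then have "exp (2 * Re (complex_of_real (- (ln pi / 4)))) = sqrt (1 / pi)"
    by (simp only:) simp
  then show ?thesis
    using wigner_gauss[of 1 0 0 0 "complex_of_real (- (ln pi / 4))"]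
    by (simp add: vacuum_eq_gauss)
qed

text \<open>Since \<alpha> (1 + w) - cnj \<alpha> (1 - w) = 2 (w Re \<alpha> + i Im \<alpha>), the
  centre is sqrt 2 (Re \<alpha>, Im \<alpha>). The last clause carries the non-vacuum hypothesis
  over to the Wigner parameters, where strictness is proved.\<close>

lemma wigner_gaussian_state:
  obtains a s q0 p0 where "a > 0"
    "wigner (displacement \<alpha> (squeezing \<zeta> vacuum)) = gauss_wigner a s (q0, p0)"
    "a = 1 \<Longrightarrow> s = 0 \<Longrightarrow> (q0, p0) = (0, 0) \<Longrightarrow> (\<alpha>, \<zeta>) = (0, 0)"
proof -
  obtain w c where w: "Re w > 0" "exp (2 * Re c) = sqrt (Re w / pi)"
    "squeezing \<zeta> vacuum \<in> L2" "AE x in lborel. squeezing \<zeta> vacuum x = gauss w 0 c x"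
    "w = 1 \<Longrightarrow> \<zeta> = 0"
    using squeezing_vacuum by blast
  define \<beta> where "\<beta> = (\<alpha> * (1 + w) - cnj \<alpha> * (1 - w)) / complex_of_real (sqrt 2)"
  define \<gamma> where "\<gamma> = c - (\<alpha> + cnj \<alpha>) * \<beta> / complex_of_real (sqrt 2) / 2"
  define q0 where "q0 = sqrt 2 * Re \<alpha>"
  define p0 where "p0 = sqrt 2 * Im \<alpha>"
  have D: "displacement \<alpha> (squeezing \<zeta> vacuum) \<in> L2"
    "AE x in lborel. displacement \<alpha> (squeezing \<zeta> vacuum) x = gauss w \<beta> \<gamma> x"
    using displacement_gauss[OF w(1,3,4), of \<alpha>] by (simp_all add: \<beta>_def \<gamma>_def)
  have s2: "2 * z / complex_of_real (sqrt 2) = complex_of_real (sqrt 2) * z" for z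
    by (simp add: field_simps flip: of_real_mult)
  have "\<alpha> * (1 + w) - cnj \<alpha> * (1 - w) = 2 * (w * Re \<alpha> + \<i> * Im \<alpha>)"
    by (simp add: complex_eq_iff algebra_simps)
  then have \<beta>: "\<beta> = w * complex_of_real q0 + \<i> * complex_of_real p0"
    unfolding \<beta>_def by (simp only: s2) (simp add: q0_def p0_def algebra_simps)
  have "\<alpha> + cnj \<alpha> = 2 * complex_of_real (Re \<alpha>)" by (simp add: complex_eq_iff)
  then have \<gamma>: "\<gamma> = c - complex_of_real q0 * \<beta> / 2"
    using s2[of "complex_of_real (Re \<alpha>) * \<beta>"] by (simp add: \<gamma>_def q0_def mult.assoc)
  have "2 * Re \<gamma> = 2 * Re c + - (Re w * q0\<^sup>2)"
    by (simp add: \<gamma> \<beta> power2_eq_square)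
  then have E: "exp (2 * Re \<gamma>) = sqrt (Re w / pi) * exp (- (Re w * q0\<^sup>2))"
    by (simp only: exp_add w(2))
  have "gauss w \<beta> \<gamma> \<in> borel_measurable borel"
    by (simp add: gauss_eq_poly_gauss)
  with D have "wigner (displacement \<alpha> (squeezing \<zeta> vacuum)) = wigner (gauss w \<beta> \<gamma>)"
    by (intro wigner_cong_AE) (auto dest: L2_measurable)
  also have "\<dots> = gauss_wigner (Re w) (Im w) (q0, p0)"
    by (rule wigner_gauss[OF w(1) \<beta> E])
  finally show ?thesis
    using that[of "Re w" "Im w" q0 p0] w(1,5)
    by (auto simp: complex_eq_iff q0_def p0_def)
qed

section \<open>Decreasing rearrangements of positive null sequences\<close>

text \<open>Pigeonhole: otherwise the first j + 1 entries in the order \<open>\<pi>'\<close> all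
  exceed \<open>x (\<pi> j)\<close>, so they lie among the first j entries in the order
  \<open>\<pi>\<close>.\<close>

lemma antimono_rearrangement_le:
  fixes x :: "nat \<Rightarrow> real" and \<pi> \<pi>' :: "nat \<Rightarrow> nat"
  assumes "bij \<pi>" "bij \<pi>'" "antimono (x \<circ> \<pi>)" "antimono (x \<circ> \<pi>')"
  shows "x (\<pi>' j) \<le> x (\<pi> j)"
proof (rule ccontr)
  assume less: "\<not> x (\<pi>' j) \<le> x (\<pi> j)"
  have "\<pi>' ` {..j} \<subseteq> \<pi> ` {..<j}"
  proof clarify
    fix i assume "i \<le> j"
    then have "x (\<pi>' j) \<le> x (\<pi>' i)"
      using assms(4) by (auto dest: antimonoD)
    moreover obtain l where l: "\<pi>' i = \<pi> l"
      using bij_is_surj[OF assms(1)] by (metis surjD)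
    ultimately have "x (\<pi> j) < x (\<pi> l)" using less by simp
    then have "l < j"
      using antimonoD[OF assms(3), of j l] by (cases "j \<le> l") auto
    then show "\<pi>' i \<in> \<pi> ` {..<j}" using l by simp
  qed
  then have "card (\<pi>' ` {..j}) \<le> card (\<pi> ` {..<j})"
    by (intro card_mono) auto
  moreover have "card (\<pi>' ` {..j}) = Suc j" "card (\<pi> ` {..<j}) = j"
    using assms(1,2) by (simp_all add: card_image bij_is_inj inj_on_subset[OF bij_is_inj])
  ultimately show False by simp
qed

text \<open>A non-increasing \<open>y\<close> with infinitely many positive entries has no zero
  entry, so the partial matching in the definition is a permutation of all indices.\<close>

lemma is_decr_rearrangement_pos_iff:
  assumes pos: "\<And>j. x j > 0"
  shows "is_decr_rearrangement x y \<longleftrightarrow> antimono y \<and> (\<exists>\<pi>. bij \<pi> \<and> y = x \<circ> \<pi>)"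
proof
  assume "is_decr_rearrangement x y"
  then obtain \<pi> where y: "antimono y" "bij_betw \<pi> {j. y j \<noteq> 0} {j. x j \<noteq> 0}"
      "\<And>j. y j \<noteq> 0 \<Longrightarrow> y j = x (\<pi> j)"
    unfolding is_decr_rearrangement_def by blast
  have UNIV: "{j. x j \<noteq> 0} = UNIV" using pos by (auto simp: less_le)
  have inf: "infinite {j. y j \<noteq> 0}"
    using bij_betw_finite[OF y(2)] UNIV by simp
  have "y j > 0" for j
  proof -
    obtain i where "i > j" "y i \<noteq> 0"
      using inf unfolding infinite_nat_iff_unbounded by blast
    then have "0 < y i" "y i \<le> y j"
      using y(3)[of i] pos antimonoD[OF y(1), of j i] by auto
    then show ?thesis by simp
  qed
  then have "{j. y j \<noteq> 0} = UNIV" "\<And>j. y j = x (\<pi> j)"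
    using y(3) by (force simp: less_le)+
  then show "antimono y \<and> (\<exists>\<pi>. bij \<pi> \<and> y = x \<circ> \<pi>)"
    using y(1,2) UNIV by (auto intro!: exI[of _ \<pi>])
next
  assume "antimono y \<and> (\<exists>\<pi>. bij \<pi> \<and> y = x \<circ> \<pi>)"
  then obtain \<pi> where "antimono y" "bij \<pi>" "y = x \<circ> \<pi>" by blast
  moreover from this have "{j. x j \<noteq> 0} = UNIV" "{j. y j \<noteq> 0} = UNIV"
    using pos by (auto simp: less_le)
  ultimately show "is_decr_rearrangement x y"
    unfolding is_decr_rearrangement_def by auto
qed

text \<open>Each index is sent to the number of indices preceding it, ordered by value with ties
  broken by index. Convergence to 0 makes that number finite, and the inverse of this ranking is the
  permutation.\<close>

lemma ex_antimono_rearrangement: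
  fixes x :: "nat \<Rightarrow> real"
  assumes pos: "\<And>j. x j > 0" and lim: "x \<longlonglongrightarrow> 0"
  shows "\<exists>\<pi> :: nat \<Rightarrow> nat. bij \<pi> \<and> antimono (x \<circ> \<pi>)"
proof -
  define before where "before l = {k. x k > x l \<or> (x k = x l \<and> k < l)}" for l
  define rank where "rank l = card (before l)" for l
  have fin: "finite (before l)" for l
  proof -
    obtain N where "\<And>n. n \<ge> N \<Longrightarrow> x n < x l"
      using order_tendstoD(2)[OF lim pos[of l]] by (auto simp: eventually_sequentially)
    then have "before l \<subseteq> {..<N}"
      unfolding before_def by (auto simp: not_less) (metis not_le order_less_asym, metis less_irrefl not_le)
    then show ?thesis by (rule finite_subset) simp
  qed
  have mono: "rank k < rank l" if "k \<in> before l" for k l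
    unfolding rank_def using that fin[of l]
    by (intro psubset_card_mono) (auto simp: before_def)
  have total: "k \<in> before l \<or> l \<in> before k" if "k \<noteq> l" for k l
    using that by (auto simp: before_def)
  have "inj rank"
    using total mono by (metis injI less_irrefl)
  \<comment> \<open>\<open>rank\<close> maps the predecessors of \<open>l\<close> injectively into a
    set of the same finite size, hence onto it. The range is therefore an infinite initial segment,
    that is, everything.\<close>
  moreover have down: "{..<rank l} \<subseteq> range rank" for l
  proof -
    have "rank ` before l \<subseteq> {..<rank l}" using mono by auto
    moreover have "card (rank ` before l) = card {..<rank l}"
      using \<open>inj rank\<close> by (subst card_image) (auto simp: rank_def intro: inj_on_subset)
    ultimately have "rank ` before l = {..<rank l}"
      by (intro card_subset_eq) auto
    then show ?thesis by blast
  qed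
  have "\<exists>l. n = rank l" for n
  proof -
    have "infinite (range rank)" using \<open>inj rank\<close> by (simp add: finite_image_iff)
    then obtain l where "rank l > n"
      unfolding infinite_nat_iff_unbounded by blast
    then show "\<exists>l. n = rank l" using down[of l] by auto
  qed
  then have "surj rank" unfolding surj_def by blast
  ultimately have "bij rank" by (simp add: bij_def)
  have "antimono (x \<circ> inv rank)"
  proof (rule antimonoI)
    fix i j :: nat assume "i \<le> j"
    have r: "rank (inv rank n) = n" for n
      using \<open>surj rank\<close> by (rule surj_f_inv_f)
    have "\<not> x (inv rank i) < x (inv rank j)"
    proof
      assume "x (inv rank i) < x (inv rank j)"
      then have "rank (inv rank j) < rank (inv rank i)"
        by (intro mono) (simp add: before_def)
      with \<open>i \<le> j\<close> show False by (simp add: r)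
    qed
    then show "(x \<circ> inv rank) j \<le> (x \<circ> inv rank) i" by simp
  qed
  then show ?thesis
    using bij_imp_bij_inv[OF \<open>bij rank\<close>] by blast
qed

lemma decr_rearrangement_unique:
  fixes x :: "nat \<Rightarrow> real" and \<pi> :: "nat \<Rightarrow> nat"
  assumes pos: "\<And>j. x j > 0" and "bij \<pi>" "antimono (x \<circ> \<pi>)"
  shows "decr_rearrangement x = x \<circ> \<pi>"
  unfolding decr_rearrangement_def is_decr_rearrangement_pos_iff[OF pos]
proof (rule the_equality)
  show "antimono (x \<circ> \<pi>) \<and> (\<exists>\<pi>'. bij \<pi>' \<and> x \<circ> \<pi> = x \<circ> \<pi>')"
    using assms by blast
  fix y :: "nat \<Rightarrow> real" assume "antimono y \<and> (\<exists>\<pi>. bij \<pi> \<and> y = x \<circ> \<pi>)"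
  then obtain \<pi>' where "bij \<pi>'" "y = x \<circ> \<pi>'" "antimono (x \<circ> \<pi>')" by blast
  then show "y = x \<circ> \<pi>"
    using antimono_rearrangement_le[OF assms(2) _ assms(3)]
      antimono_rearrangement_le[OF _ assms(2) _ assms(3)]
    by (auto intro!: ext antisym)
qed

lemma decr_rearrangement_obtain:
  fixes x :: "nat \<Rightarrow> real"
  assumes "\<And>j. x j > 0" "x \<longlonglongrightarrow> 0"
  obtains \<pi> where "bij \<pi>" "decr_rearrangement x = x \<circ> \<pi>"
proof -
  obtain \<pi> :: "nat \<Rightarrow> nat" where "bij \<pi>" "antimono (x \<circ> \<pi>)"
    using ex_antimono_rearrangement[OF assms] by blast
  then show ?thesis
    using that decr_rearrangement_unique[of x \<pi>] assms(1) by blast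
qed

lemma decr_rearrangement_antimono:
  fixes x :: "nat \<Rightarrow> real"
  assumes "\<And>j. x j > 0" "antimono x"
  shows "decr_rearrangement x = x"
  using decr_rearrangement_unique[OF assms(1), of id] assms(2) by simp

text \<open>The first m entries of the rearrangement of \<open>x\<close> are the values on some set
  of m indices, so a bound over all finite index sets avoids determining the order of
  \<open>x\<close>.\<close>

lemma majorized_by_antimono:
  fixes x y :: "nat \<Rightarrow> real"
  assumes pos: "\<And>j. x j > 0" "\<And>j. y j > 0" and y: "antimono y"
    and sums: "x sums s" "y sums s"
    and le: "\<And>F. finite F \<Longrightarrow> sum x F \<le> sum y {..<card F}"
  shows "x \<preceq>\<^sub>m y"
  unfolding majorized_by_def
proof (intro conjI allI exI)
  fix m
  obtain \<pi> where \<pi>: "bij \<pi>" "decr_rearrangement x = x \<circ> \<pi>"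
    by (rule decr_rearrangement_obtain[OF pos(1) summable_LIMSEQ_zero[OF sums_summable[OF sums(1)]]])
  have inj: "inj_on \<pi> {..<m}" using bij_is_inj[OF \<pi>(1)] by (rule inj_on_subset) simp
  have "(\<Sum>j<m. decr_rearrangement x j) = sum x (\<pi> ` {..<m})"
    using inj by (simp add: \<pi>(2) sum.reindex)
  also have "\<dots> \<le> sum y {..<card (\<pi> ` {..<m})}"
    by (rule le) simp
  also have "card (\<pi> ` {..<m}) = m" using inj by (simp add: card_image)
  finally show "(\<Sum>j<m. decr_rearrangement x j) \<le> (\<Sum>j<m. decr_rearrangement y j)"
    by (simp add: decr_rearrangement_antimono[OF pos(2) y])
qed (rule sums)+

text \<open>Majorization already fails at m = 1, where only the largest entries are
  compared.\<close>

lemma not_majorized_by_if_less: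
  fixes x y :: "nat \<Rightarrow> real"
  assumes pos: "\<And>j. x j > 0" "\<And>j. y j > 0" and y: "antimono y"
    and "summable x" and less: "\<And>j. x j < y 0"
  shows "\<not> y \<preceq>\<^sub>m x"
proof
  assume "y \<preceq>\<^sub>m x"
  then have "(\<Sum>j<1. decr_rearrangement y j) \<le> (\<Sum>j<1. decr_rearrangement x j)"
    unfolding majorized_by_def by blast
  moreover obtain \<pi> where \<pi>: "bij \<pi>" "decr_rearrangement x = x \<circ> \<pi>"
    by (rule decr_rearrangement_obtain[OF pos(1) summable_LIMSEQ_zero[OF assms(4)]])
  ultimately show False
    using less[of "\<pi> 0"] by (simp add: decr_rearrangement_antimono[OF pos(2) y])
qed

section \<open>Gaussian Wigner functions on unions of shells\<close>

text \<open>Prepares the area computation by subtraction; for \<open>j = 0\<close> the inner ball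
  has radius 0 and is empty.\<close>

lemma shell_eq_ball_diff:
  "shell \<Delta> (Suc j) = ball 0 (sqrt (real (Suc j) * \<Delta>)) - ball 0 (sqrt (real j * \<Delta>))"
proof -
  have *: "norm r < sqrt c \<longleftrightarrow> (norm r)\<^sup>2 < c" for r :: "real \<times> real" and c
    using real_sqrt_less_iff[of "(norm r)\<^sup>2" c] by simp
  show ?thesis by (auto simp: shell_def *)
qed

lemma sets_shell [measurable]: "shell \<Delta> k \<in> sets borel"
proof -
  have "closed {r :: real \<times> real. (real k - 1) * \<Delta> \<le> (norm r)\<^sup>2}"
    by (intro closed_Collect_le continuous_intros)
  moreover have "open {r :: real \<times> real. (norm r)\<^sup>2 < real k * \<Delta>}"
    by (intro open_Collect_less continuous_intros)
  moreover have "shell \<Delta> k = {r. (real k - 1) * \<Delta> \<le> (norm r)\<^sup>2} \<inter> {r. (norm r)\<^sup>2 < real k * \<Delta>}"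
    by (auto simp: shell_def)
  ultimately show ?thesis by (metis borel_closed borel_open sets.Int)
qed

lemma emeasure_shell:
  assumes "\<Delta> > 0"
  shows "emeasure lborel (shell \<Delta> (Suc j)) = ennreal (pi * \<Delta>)"
proof -
  have ball: "emeasure lborel (ball (0 :: real \<times> real) (sqrt (real k * \<Delta>))) = ennreal (pi * (real k * \<Delta>))"
    for k :: nat
    using assms by (simp add: emeasure_ball unit_ball_vol_2)
  have "emeasure lborel (shell \<Delta> (Suc j)) =
      emeasure lborel (ball (0 :: real \<times> real) (sqrt (real (Suc j) * \<Delta>))) -
      emeasure lborel (ball (0 :: real \<times> real) (sqrt (real j * \<Delta>)))"
    unfolding shell_eq_ball_diff
    by (rule emeasure_Diff) (use assms in \<open>auto simp: ball mult_right_mono intro!: subset_ball\<close>)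
  also have "\<dots> = ennreal (pi * (real (Suc j) * \<Delta>) - pi * (real j * \<Delta>))"
    unfolding ball using assms by (intro ennreal_minus) simp
  also have "pi * (real (Suc j) * \<Delta>) - pi * (real j * \<Delta>) = pi * \<Delta>"
    by (simp add: algebra_simps)
  finally show ?thesis .
qed

lemma disjoint_shells:
  assumes "\<Delta> > 0"
  shows "disjoint_family_on (\<lambda>j. shell \<Delta> (Suc j)) F"
  unfolding disjoint_family_on_def
proof (intro ballI impI)
  have *: "shell \<Delta> (Suc i) \<inter> shell \<Delta> (Suc j) = {}" if "i < j" for i j
  proof -
    have "real (Suc i) * \<Delta> \<le> real j * \<Delta>"
      using that assms by (intro mult_right_mono) auto
    then show ?thesis by (auto simp: shell_def)
  qed
  show "shell \<Delta> (Suc i) \<inter> shell \<Delta> (Suc j) = {}" if "i \<noteq> j" for i j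
    using *[of i j] *[of j i] that by (auto simp: neq_iff)
qed

lemma Union_shells_lessThan:
  assumes "\<Delta> > 0"
  shows "(\<Union>j<m. shell \<Delta> (Suc j)) = {r. (norm r)\<^sup>2 < real m * \<Delta>}"
proof (induction m)
  case (Suc m)
  have "real m * \<Delta> \<le> real (Suc m) * \<Delta>"
    using assms by (intro mult_right_mono) auto
  with Suc show ?case by (auto simp: lessThan_Suc shell_def)
qed auto

lemma Union_shells:
  assumes "\<Delta> > 0"
  shows "(\<Union>j. shell \<Delta> (Suc j)) = UNIV"
proof -
  have "\<exists>m. r \<in> (\<Union>j<m. shell \<Delta> (Suc j))" for r
  proof -
    obtain m :: nat where "(norm r)\<^sup>2 / \<Delta> < real m" using reals_Archimedean2 by blast
    then show ?thesis
      unfolding Union_shells_lessThan[OF assms] using assms by (auto simp: divide_simps)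
  qed
  then show ?thesis by blast
qed

lemma emeasure_Union_shells:
  assumes "\<Delta> > 0" "finite F"
  shows "emeasure lborel (\<Union>j\<in>F. shell \<Delta> (Suc j)) = ennreal (card F * (pi * \<Delta>))"
proof -
  have "emeasure lborel (\<Union>j\<in>F. shell \<Delta> (Suc j)) = (\<Sum>j\<in>F. emeasure lborel (shell \<Delta> (Suc j)))"
    using assms by (intro sum_emeasure[symmetric] disjoint_shells) auto
  also have "\<dots> = ennreal (card F * (pi * \<Delta>))"
    using assms by (simp add: emeasure_shell ennreal_of_nat_eq_real_of_nat ennreal_mult)
  finally show ?thesis .
qed

section \<open>Area-preserving reduction to the vacuum\<close>

definition normal_form :: "real \<Rightarrow> real \<Rightarrow> real \<times> real \<Rightarrow> real \<times> real \<Rightarrow> real \<times> real" where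
  "normal_form a s = (\<lambda>(q0, p0) (q, p). (sqrt a * (q - q0), (p - p0 + s * (q - q0)) / sqrt a))"

lemma gauss_wigner_normal_form:
  assumes "a > 0"
  shows "gauss_wigner a s r0 r = exp (- (norm (normal_form a s r0 r))\<^sup>2) / pi"
  using assms
  by (cases r0; cases r)
     (simp add: gauss_wigner_def normal_form_def norm_Pair power_mult_distrib power_divide)

lemma gauss_wigner_vacuum: "gauss_wigner 1 0 (0, 0) r = exp (- (norm r)\<^sup>2) / pi"
  by (simp add: gauss_wigner_normal_form normal_form_def split: prod.split)

lemma continuous_normal_form: "continuous_on A (normal_form a s r0)"
  unfolding normal_form_def case_prod_beta
  by (cases "a = 0") (auto intro!: continuous_intros)

lemma borel_measurable_gauss_wigner [measurable]:
  assumes "a > 0"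
  shows "gauss_wigner a s r0 \<in> borel_measurable borel"
  unfolding gauss_wigner_normal_form[OF assms, abs_def]
  by (intro borel_measurable_continuous_onI continuous_intros continuous_normal_form) auto

text \<open>By Tonelli the shear is, for fixed q, a translation in p; scaling p contributes the
  factor sqrt a and scaling q the factor 1 / sqrt a.\<close>

lemma nn_integral_normal_form:
  assumes a: "a > 0" and [measurable]: "g \<in> borel_measurable borel"
  shows "(\<integral>\<^sup>+r. g (normal_form a s r0 r) \<partial>lborel) = (\<integral>\<^sup>+r. g r \<partial>(lborel :: (real \<times> real) measure))"
proof -
  obtain q0 p0 where r0: "r0 = (q0, p0)" by (cases r0)
  have [measurable]: "g \<in> borel_measurable (borel \<Otimes>\<^sub>M borel)" by (simp add: borel_prod)
  have [measurable]: "normal_form a s r0 \<in> borel \<rightarrow>\<^sub>M borel"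
    by (intro borel_measurable_continuous_onI continuous_normal_form)
  have [measurable]: "normal_form a s r0 \<in> borel \<Otimes>\<^sub>M borel \<rightarrow>\<^sub>M borel"
    by (simp add: borel_prod)
  have "(\<integral>\<^sup>+r. g (normal_form a s r0 r) \<partial>lborel) =
      (\<integral>\<^sup>+q. \<integral>\<^sup>+p. g (normal_form a s r0 (q, p)) \<partial>lborel \<partial>lborel)"
    unfolding lborel_prod[symmetric] by (rule lborel.nn_integral_fst[symmetric]) measurable
  also have "\<dots> = (\<integral>\<^sup>+q. sqrt a * (\<integral>\<^sup>+p. g (sqrt a * (q - q0), p) \<partial>lborel) \<partial>lborel)"
  proof (intro nn_integral_cong)
    fix q :: real
    have "(\<integral>\<^sup>+p. g (normal_form a s r0 (q, p)) \<partial>lborel) =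
       ennreal \<bar>sqrt a\<bar> * (\<integral>\<^sup>+p. g (normal_form a s r0 (q, (p0 - s * (q - q0)) + sqrt a * p)) \<partial>lborel)"
    proof (rule nn_integral_real_affine)
      have "(\<lambda>p. normal_form a s r0 (q, p)) \<in> borel \<rightarrow>\<^sub>M borel"
        by (intro borel_measurable_continuous_onI
            continuous_on_compose2[OF continuous_normal_form[of UNIV]] continuous_intros) auto
      then show "(\<lambda>p. g (normal_form a s r0 (q, p))) \<in> borel_measurable borel"
        by (rule measurable_compose) fact
    qed (use a in simp)
    then show "(\<integral>\<^sup>+p. g (normal_form a s r0 (q, p)) \<partial>lborel) =
       sqrt a * (\<integral>\<^sup>+p. g (sqrt a * (q - q0), p) \<partial>lborel)"
      using a by (simp add: normal_form_def r0)
  qed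
  also have "\<dots> = ennreal \<bar>1 / sqrt a\<bar> * (\<integral>\<^sup>+q. sqrt a *
      (\<integral>\<^sup>+p. g (sqrt a * (q0 + 1 / sqrt a * q - q0), p) \<partial>lborel) \<partial>lborel)"
    using a by (intro nn_integral_real_affine) simp_all
  also have "\<dots> = (\<integral>\<^sup>+q. \<integral>\<^sup>+p. g (q, p) \<partial>lborel \<partial>lborel)"
    using a by (simp add: nn_integral_cmult flip: mult.assoc ennreal_mult)
  also have "\<dots> = (\<integral>\<^sup>+r. g r \<partial>(lborel :: (real \<times> real) measure))"
    unfolding lborel_prod[symmetric] by (rule lborel.nn_integral_fst) measurable
  finally show ?thesis .
qed

lemma integral_normal_form:
  fixes g :: "real \<times> real \<Rightarrow> real"
  assumes a: "a > 0" and [measurable]: "g \<in> borel_measurable borel" and "\<And>r. g r \<ge> 0"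
  shows "(LINT r|lborel. g (normal_form a s r0 r)) = (LINT r|lborel. g r)"
proof -
  have [measurable]: "normal_form a s r0 \<in> borel \<rightarrow>\<^sub>M borel"
    by (intro borel_measurable_continuous_onI continuous_normal_form)
  show ?thesis
    using nn_integral_normal_form[OF a, of "\<lambda>r. ennreal (g r)" s r0] assms(3)
    by (simp add: integral_eq_nn_integral)
qed

lemma integrable_gauss_wigner:
  assumes "a > 0"
  shows "integrable lborel (gauss_wigner a s r0)"
proof -
  let ?g = "\<lambda>x::real. ennreal (exp (- (1 * x\<^sup>2)))"
  have [measurable]: "(\<lambda>r :: real \<times> real. ennreal (exp (- (norm r)\<^sup>2) / pi)) \<in> borel_measurable borel"
    by measurable
  have fin: "(\<integral>\<^sup>+x. ?g x \<partial>lborel) < \<infinity>"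
    using integrable_exp_neg_sq[of 1] by (simp add: integrable_iff_bounded)
  have "(\<integral>\<^sup>+r. ennreal (gauss_wigner a s r0 r) \<partial>lborel) = (\<integral>\<^sup>+r. ennreal (exp (- (norm r)\<^sup>2) / pi) \<partial>(lborel :: (real \<times> real) measure))"
    unfolding gauss_wigner_normal_form[OF assms]
    by (rule nn_integral_normal_form[OF assms]) measurable
  also have "\<dots> = (\<integral>\<^sup>+q. \<integral>\<^sup>+p. ennreal (exp (- (norm (q :: real, p :: real))\<^sup>2) / pi) \<partial>lborel \<partial>lborel)"
    unfolding lborel_prod[symmetric]
    by (subst lborel.nn_integral_fst) (simp_all add: lborel_prod)
  also have "\<dots> \<le> (\<integral>\<^sup>+q. \<integral>\<^sup>+p. ?g q * ?g p \<partial>lborel \<partial>lborel)"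
  proof (intro nn_integral_mono)
    fix q p :: real
    have "exp (- (norm (q, p))\<^sup>2) / pi \<le> exp (- (norm (q, p))\<^sup>2)"
      using pi_ge_two by (simp add: divide_le_eq)
    also have "\<dots> = exp (- (1 * q\<^sup>2)) * exp (- (1 * p\<^sup>2))"
      by (simp add: norm_Pair flip: exp_add)
    finally show "ennreal (exp (- (norm (q, p))\<^sup>2) / pi) \<le> ?g q * ?g p"
      by (simp add: ennreal_leI flip: ennreal_mult)
  qed
  also have "\<dots> = (\<integral>\<^sup>+x. ?g x \<partial>lborel) * (\<integral>\<^sup>+x. ?g x \<partial>lborel)"
    by (simp add: nn_integral_cmult nn_integral_multc)
  also have "\<dots> < \<infinity>" using fin by (simp add: ennreal_mult_less_top)
  finally show ?thesis
    using assms
    by (subst integrable_iff_bounded) (simp add: gauss_wigner_normal_form)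
qed

section \<open>Integrals over sets of prescribed area\<close>

context
  fixes a s \<Delta> :: real and r0 :: "real \<times> real"
  assumes a: "a > 0" and \<Delta>: "\<Delta> > 0"
begin

private abbreviation W where "W \<equiv> gauss_wigner a s r0"
private abbreviation V where "V \<equiv> gauss_wigner 1 0 (0, 0)"
private abbreviation A where "A j \<equiv> shell \<Delta> (Suc j)"

lemmas [measurable] = borel_measurable_gauss_wigner[OF a] borel_measurable_gauss_wigner[of 1, simplified]

lemma gauss_wigner_pos: "W r > 0"
  by (simp add: gauss_wigner_normal_form[OF a])

lemma set_integrable_gauss_wigner: "B \<in> sets borel \<Longrightarrow> set_integrable lborel B W"
  unfolding set_integrable_def
  using integrable_gauss_wigner[OF a] by (intro integrable_mult_indicator) auto

lemma integral_gauss_wigner: "(LINT r|lborel. W r) = (LINT r|lborel. V r)"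
  unfolding gauss_wigner_normal_form[OF a] gauss_wigner_vacuum
  by (rule integral_normal_form[OF a]) auto

text \<open>The excess over a level depends only on how large the superlevel sets are, and
  \<open>W\<close> is the vacuum function composed with an area-preserving map. All dependence on
  the state disappears here.\<close>

lemma integral_gauss_wigner_excess:
  "(LINT r|lborel. max 0 (W r - c)) = (LINT r|lborel. max 0 (V r - c))"
  unfolding gauss_wigner_normal_form[OF a] gauss_wigner_vacuum
  by (rule integral_normal_form[OF a]) auto

lemma integrable_excess:
  assumes "c \<ge> 0"
  shows "integrable lborel (\<lambda>r. max 0 (W r - c))"
  using assms gauss_wigner_pos
  by (intro Bochner_Integration.integrable_bound[OF integrable_gauss_wigner[OF a, of s r0]])
     (auto intro!: AE_I2 simp: less_imp_le max_def abs_of_pos)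

lemma set_integral_eq_excess:
  assumes [measurable]: "B \<in> sets borel" and B: "emeasure lborel B = ennreal m" "m \<ge> 0"
  shows "integrable lborel (\<lambda>r. indicator B r * (W r - c))"
    and "(LINT r:B|lborel. W r) = (LINT r|lborel. indicator B r * (W r - c)) + c * m"
proof -
  have 1: "integrable lborel (\<lambda>r. indicator B r * W r)"
    using set_integrable_gauss_wigner[of B] by (simp add: set_integrable_def)
  have 2: "integrable lborel (\<lambda>r. c * indicator B r)"
    using B by (intro integrable_mult_right) (simp add: integrable_indicator_iff)
  have eq: "(\<lambda>r. indicator B r * (W r - c)) = (\<lambda>r. indicator B r * W r - c * indicator B r)"
    by (simp add: algebra_simps)
  show "integrable lborel (\<lambda>r. indicator B r * (W r - c))"
    unfolding eq using 1 2 by (rule Bochner_Integration.integrable_diff)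
  have "(LINT r|lborel. indicator B r * (W r - c)) = (LINT r:B|lborel. W r) - c * m"
    unfolding eq using 1 2 B
    by (subst Bochner_Integration.integral_diff)
       (simp_all add: set_lebesgue_integral_def measure_def)
  then show "(LINT r:B|lborel. W r) = (LINT r|lborel. indicator B r * (W r - c)) + c * m" by simp
qed

text \<open>Bathtub principle: W - c restricted to \<open>B\<close> never exceeds the positive part
  of W - c.\<close>

lemma set_integral_le_excess:
  assumes [measurable]: "B \<in> sets borel" and B: "emeasure lborel B = ennreal m" "m \<ge> 0"
    and "c \<ge> 0"
  shows "(LINT r:B|lborel. W r) \<le> (LINT r|lborel. max 0 (V r - c)) + c * m"
proof -
  have "(LINT r|lborel. indicator B r * (W r - c)) \<le> (LINT r|lborel. max 0 (W r - c))"
    by (rule integral_mono[OF set_integral_eq_excess(1)[OF assms(1-3)] integrable_excess[OF assms(4)]])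
       (auto simp: indicator_def)
  then show ?thesis
    using set_integral_eq_excess(2)[OF assms(1-3), of c] by (simp add: integral_gauss_wigner_excess)
qed

text \<open>On \<open>U\<close> the positive part is 0 while the restricted integrand is negative.
  Equality of the integrals would make \<open>U\<close> a null set, impossible for a non-empty open
  set.\<close>

lemma set_integral_less_excess:
  assumes [measurable]: "B \<in> sets borel" and B: "emeasure lborel B = ennreal m" "m \<ge> 0"
    and "c \<ge> 0" and U: "open U" "U \<noteq> {}" "U \<subseteq> B" "\<And>r. r \<in> U \<Longrightarrow> W r < c"
  shows "(LINT r:B|lborel. W r) < (LINT r|lborel. max 0 (V r - c)) + c * m"
proof (rule ccontr)
  let ?d = "\<lambda>r. max 0 (W r - c) - indicator B r * (W r - c)"
  note i = set_integral_eq_excess(1)[OF assms(1-3), of c] integrable_excess[OF assms(4)]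
  have i': "integrable lborel ?d" using i(2) i(1) by (rule Bochner_Integration.integrable_diff)
  have nonneg: "?d r \<ge> 0" for r by (auto simp: indicator_def)
  assume "\<not> ?thesis"
  then have "(LINT r|lborel. max 0 (W r - c)) \<le> (LINT r|lborel. indicator B r * (W r - c))"
    using set_integral_eq_excess(2)[OF assms(1-3), of c] by (simp add: integral_gauss_wigner_excess)
  then have "(LINT r|lborel. ?d r) \<le> 0"
    using i by simp
  moreover have "(LINT r|lborel. ?d r) \<ge> 0"
    using nonneg by (intro integral_nonneg_AE) auto
  ultimately have "AE r in lborel. ?d r = 0"
    using integral_nonneg_eq_0_iff_AE[OF i'] nonneg by auto
  then have "AE r in lborel. r \<notin> U"
  proof eventually_elim
    case (elim r)
    then show ?case using U(3) U(4)[of r] by (auto simp: indicator_def max_def split: if_splits)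
  qed
  then have "U \<in> null_sets lborel"
    using U(1) AE_iff_null_sets[of U lborel] by simp
  then show False
    using open_not_negligible[OF U(1,2)]
    by (simp add: negligible_iff_null_sets null_sets_completionI)
qed

lemma sum_shell_integrals:
  assumes "finite F"
  shows "(\<Sum>j\<in>F. LINT r:A j|lborel. W r) = (LINT r:(\<Union>j\<in>F. A j)|lborel. W r)"
  using assms disjoint_shells[OF \<Delta>]
  by (intro set_integral_finite_Union[symmetric] set_integrable_gauss_wigner) auto

text \<open>Positivity of every entry is what makes \<open>decr_rearrangement\<close> a genuine
  permutation of the shell probabilities.\<close>

lemma shell_integral_pos: "(LINT r:A j|lborel. W r) > 0"
proof (rule ccontr)
  have i: "integrable lborel (\<lambda>r. indicator (A j) r * W r)"
    using set_integrable_gauss_wigner[of "A j"] by (simp add: set_integrable_def)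
  have nn: "indicator (A j) r * W r \<ge> 0" for r
    using gauss_wigner_pos[of r] by (simp add: less_imp_le)
  assume "\<not> ?thesis"
  then have "(LINT r|lborel. indicator (A j) r * W r) \<le> 0"
    by (simp add: set_lebesgue_integral_def)
  moreover have "(LINT r|lborel. indicator (A j) r * W r) \<ge> 0"
    using nn by (intro integral_nonneg_AE) auto
  ultimately have "AE r in lborel. indicator (A j) r * W r = 0"
    using integral_nonneg_eq_0_iff_AE[OF i] nn by auto
  then have "AE r in lborel. r \<notin> A j"
    by eventually_elim (use gauss_wigner_pos in \<open>auto simp: indicator_def less_le split: if_splits\<close>)
  then have "A j \<in> null_sets lborel"
    using AE_iff_null_sets[of "A j" lborel] by simp
  then show False
    using emeasure_shell[OF \<Delta>, of j] \<Delta> by (simp add: null_sets_def)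
qed

text \<open>The total is written as an integral of the vacuum function so that all states have
  literally the same sum, as majorization demands.\<close>

lemma shell_integrals_sums: "(\<lambda>j. LINT r:A j|lborel. W r) sums (LINT r|lborel. V r)"
proof -
  have int: "set_integrable lborel (\<Union>j. A j) W"
    by (intro set_integrable_gauss_wigner) auto
  have "(\<lambda>j. LINT r:A j|lborel. W r) sums (LINT r:(\<Union>j. A j)|lborel. W r)"
  proof -
    have "(\<lambda>n. LINT r:(\<Union>j<n. A j)|lborel. W r) \<longlonglongrightarrow> (LINT r:(\<Union>n. \<Union>j<n. A j)|lborel. W r)"
    proof (rule set_integral_cont_up)
      show "incseq (\<lambda>n. \<Union>j<n. A j)" by (intro monoI UN_mono) auto
    qed (auto intro!: set_integrable_gauss_wigner)
    moreover have "(\<Union>n. \<Union>j<n. A j) = (\<Union>j. A j)" by auto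
    ultimately show ?thesis
      by (simp add: sums_def sum_shell_integrals)
  qed
  then show ?thesis
    by (simp add: Union_shells[OF \<Delta>] set_lebesgue_integral_def integral_gauss_wigner)
qed

end

section \<open>Comparison with the vacuum, and strictness\<close>

lemma norm_normal_form_sq:
  assumes "a > 0"
  shows "(norm (normal_form a s (q0, p0) (q, p)))\<^sup>2 = a * (q - q0)\<^sup>2 + (p - p0 + s * (q - q0))\<^sup>2 / a"
  using assms by (simp add: normal_form_def norm_Pair power_mult_distrib power_divide)

text \<open>Otherwise the ellipse \<open>norm (normal_form a s r0 r) \<le> sqrt \<Delta>\<close> contains the outer boundary circle
  of the shell, whose radius is at least \<open>sqrt \<Delta>\<close>. Adding up the quadratic form at the four points of
  this circle on the coordinate axes then bounds its trace \<open>a + 1 / a + s\<^sup>2 / a \<ge> 2\<close> from above.\<close>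

lemma shell_not_subset_ellipse:
  assumes a: "a > 0" and \<Delta>: "\<Delta> > 0" and ne: "\<not> (a = 1 \<and> s = 0 \<and> r0 = (0, 0))"
  obtains r where "real j * \<Delta> < (norm r)\<^sup>2" "(norm r)\<^sup>2 < real (Suc j) * \<Delta>"
    "(norm (normal_form a s r0 r))\<^sup>2 > \<Delta>"
proof (rule ccontr)
  assume "\<not> thesis"
  with that have sub: "(norm (normal_form a s r0 r))\<^sup>2 \<le> \<Delta>"
    if "real j * \<Delta> < (norm r)\<^sup>2" "(norm r)\<^sup>2 < real (Suc j) * \<Delta>" for r
    using that not_le by blast
  \<comment> \<open>The outer circle does not belong to the shell; the bound reaches it as the
    radial limit of t r for t tending to 1 from below.\<close>
  have circle: "(norm (normal_form a s r0 r))\<^sup>2 \<le> \<Delta>" if r: "(norm r)\<^sup>2 = real (Suc j) * \<Delta>" for r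
  proof (rule tendsto_upperbound)
    have "continuous_on UNIV (\<lambda>t. (norm (normal_form a s r0 (t *\<^sub>R r)))\<^sup>2)"
      by (intro continuous_on_power continuous_on_norm
          continuous_on_compose2[OF continuous_normal_form[of UNIV]] continuous_on_scaleR
          continuous_on_id continuous_on_const) auto
    then have "((\<lambda>t. (norm (normal_form a s r0 (t *\<^sub>R r)))\<^sup>2) \<longlongrightarrow>
        (norm (normal_form a s r0 (1 *\<^sub>R r)))\<^sup>2) (at 1)"
      unfolding continuous_on_eq_continuous_at[OF open_UNIV] isCont_def by blast
    then show "((\<lambda>t. (norm (normal_form a s r0 (t *\<^sub>R r)))\<^sup>2) \<longlongrightarrow> (norm (normal_form a s r0 r))\<^sup>2) (at_left 1)"
      unfolding filterlim_at_split by simp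
    have "((\<lambda>t. (norm (t *\<^sub>R r))\<^sup>2) \<longlongrightarrow> (norm (1 *\<^sub>R r))\<^sup>2) (at_left (1::real))"
      by (intro tendsto_intros)
    moreover have "real j * \<Delta> < (norm (1 *\<^sub>R r))\<^sup>2"
      using r \<Delta> by simp
    ultimately have "\<forall>\<^sub>F t in at_left (1::real). real j * \<Delta> < (norm (t *\<^sub>R r))\<^sup>2"
      by (rule order_tendstoD(1))
    moreover have "\<forall>\<^sub>F t in at_left (1::real). t \<in> {0<..<1}"
      by (rule eventually_at_left_real) simp
    ultimately show "\<forall>\<^sub>F t in at_left 1. (norm (normal_form a s r0 (t *\<^sub>R r)))\<^sup>2 \<le> \<Delta>"
    proof eventually_elim
      case (elim t)
      have "(norm (t *\<^sub>R r))\<^sup>2 = t\<^sup>2 * (real (Suc j) * \<Delta>)"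
        using r by (simp add: power_mult_distrib)
      also have "\<dots> < 1 * (real (Suc j) * \<Delta>)"
        using elim \<Delta> by (intro mult_strict_right_mono) (auto simp: abs_square_less_1)
      finally show ?case using elim(1) by (intro sub) simp_all
    qed
  qed simp
  obtain q0 p0 where r0: "r0 = (q0, p0)" by (cases r0)
  define R where "R = sqrt (real (Suc j) * \<Delta>)"
  have R2: "R\<^sup>2 = real (Suc j) * \<Delta>" using \<Delta> by (simp add: R_def)
  define Q0 where "Q0 = a * q0\<^sup>2 + (p0 + s * q0)\<^sup>2 / a"
  have Q0: "Q0 \<ge> 0" using a by (simp add: Q0_def)
  note four = circle[of "(R, 0)"] circle[of "(- R, 0)"] circle[of "(0, R)"] circle[of "(0, - R)"]
  have four': "a * (R - q0)\<^sup>2 + (- p0 + s * (R - q0))\<^sup>2 / a \<le> \<Delta>"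
    "a * (- R - q0)\<^sup>2 + (- p0 + s * (- R - q0))\<^sup>2 / a \<le> \<Delta>"
    "a * (0 - q0)\<^sup>2 + (R - p0 + s * (0 - q0))\<^sup>2 / a \<le> \<Delta>"
    "a * (0 - q0)\<^sup>2 + (- R - p0 + s * (0 - q0))\<^sup>2 / a \<le> \<Delta>"
    using four R2 a \<Delta> by (simp_all add: r0 norm_normal_form_sq norm_Pair)
  have id: "(a * (R - q0)\<^sup>2 + (- p0 + s * (R - q0))\<^sup>2 / a) +
     (a * (- R - q0)\<^sup>2 + (- p0 + s * (- R - q0))\<^sup>2 / a) +
     (a * (0 - q0)\<^sup>2 + (R - p0 + s * (0 - q0))\<^sup>2 / a) +
     (a * (0 - q0)\<^sup>2 + (- R - p0 + s * (0 - q0))\<^sup>2 / a) =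
     2 * R\<^sup>2 * (2 + ((a - 1)\<^sup>2 + s\<^sup>2) / a) + 4 * Q0"
    using a by (simp add: Q0_def field_simps power2_eq_square)
  \<comment> \<open>The trace of the quadratic form is 2 + E. In the sum over opposite points the
    terms linear in \<open>R\<close> cancel, so the centre enters only through the nonnegative
    \<open>Q0\<close>.\<close>
  define E where "E = ((a - 1)\<^sup>2 + s\<^sup>2) / a"
  have E: "E \<ge> 0" using a by (simp add: E_def)
  have "2 * R\<^sup>2 * (2 + E) + 4 * Q0 \<le> 4 * \<Delta>"
    using four' unfolding id[folded E_def, symmetric] by linarith
  \<comment> \<open>The shell index matters only here, through R^2 = (j + 1) \<Delta> \<ge>
    \<Delta>.\<close>
  moreover have "2 * \<Delta> * (2 + E) \<le> 2 * R\<^sup>2 * (2 + E)"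
    using E \<Delta> unfolding R2 by (intro mult_right_mono) (auto simp: algebra_simps)
  ultimately have "\<Delta> * E + 2 * Q0 \<le> 0" by (simp add: algebra_simps)
  moreover have "\<Delta> * E \<ge> 0" using \<Delta> E by simp
  ultimately have "\<Delta> * E = 0" "Q0 = 0" using Q0 by linarith+
  then have "(a - 1)\<^sup>2 + s\<^sup>2 = 0" "a * q0\<^sup>2 + (p0 + s * q0)\<^sup>2 / a = 0"
    using \<Delta> a by (simp_all add: E_def Q0_def)
  then have as: "a = 1" "s = 0" by (simp_all add: sum_power2_eq_zero_iff)
  with \<open>a * q0\<^sup>2 + (p0 + s * q0)\<^sup>2 / a = 0\<close> have "q0 = 0" "p0 = 0"
    by (simp_all add: sum_power2_eq_zero_iff)
  with as ne show False by (simp add: r0)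
qed

text \<open>Equality in the bathtub bound: the first m shells fill the disc on which the vacuum
  function exceeds the level \<open>exp (- (real m * \<Delta>)) / pi\<close>, so restricting to it
  is taking the positive part.\<close>

lemma vacuum_disc_integral:
  assumes \<Delta>: "\<Delta> > 0"
  shows "(\<Sum>j<m. LINT r:shell \<Delta> (Suc j)|lborel. gauss_wigner 1 0 (0, 0) r) =
    (LINT r|lborel. max 0 (gauss_wigner 1 0 (0, 0) r - exp (- (real m * \<Delta>)) / pi)) +
    exp (- (real m * \<Delta>)) / pi * (real m * (pi * \<Delta>))"
proof -
  let ?V = "gauss_wigner 1 0 (0, 0)"
  let ?c = "exp (- (real m * \<Delta>)) / pi"
  let ?D = "\<Union>j<m. shell \<Delta> (Suc j)"
  have "emeasure lborel ?D = ennreal (real m * (pi * \<Delta>))"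
    using emeasure_Union_shells[OF \<Delta>, of "{..<m}"] by simp
  then have "(LINT r:?D|lborel. ?V r) =
      (LINT r|lborel. indicator ?D r * (?V r - ?c)) + ?c * (real m * (pi * \<Delta>))"
    using \<Delta> by (intro set_integral_eq_excess(2)) auto
  also have "(\<lambda>r. indicator ?D r * (?V r - ?c)) = (\<lambda>r. max 0 (?V r - ?c))"
    unfolding Union_shells_lessThan[OF \<Delta>] gauss_wigner_vacuum
    by (auto simp: indicator_def max_def divide_le_cancel fun_eq_iff)
  finally show ?thesis
    using \<Delta> by (simp add: sum_shell_integrals)
qed

text \<open>\<open>?c\<close> is the value on the circle separating two neighbouring shells. They
  have equal area, and the vacuum function is at least \<open>?c\<close> on the inner one and at
  most \<open>?c\<close> on the outer one.\<close>

lemma antimono_vacuum_shell_integrals: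
  assumes \<Delta>: "\<Delta> > 0"
  shows "antimono (\<lambda>j. LINT r:shell \<Delta> (Suc j)|lborel. gauss_wigner 1 0 (0, 0) r)"
proof (rule decseq_SucI)
  fix j
  let ?V = "gauss_wigner 1 0 (0, 0)"
  let ?c = "exp (- (real (Suc j) * \<Delta>)) / pi"
  have eq: "(LINT r:shell \<Delta> (Suc k)|lborel. ?V r) =
      (LINT r|lborel. indicator (shell \<Delta> (Suc k)) r * (?V r - ?c)) + ?c * (pi * \<Delta>)" for k
    using \<Delta> by (intro set_integral_eq_excess(2)[OF _ _ _ emeasure_shell]) auto
  have "0 \<le> (LINT r|lborel. - (indicator (shell \<Delta> (Suc (Suc j))) r * (?V r - ?c)))"
    by (intro integral_nonneg_AE AE_I2)
       (auto simp: indicator_def shell_def gauss_wigner_vacuum divide_le_cancel)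
  moreover have "0 \<le> (LINT r|lborel. indicator (shell \<Delta> (Suc j)) r * (?V r - ?c))"
    by (intro integral_nonneg_AE AE_I2)
       (auto simp: indicator_def shell_def gauss_wigner_vacuum divide_le_cancel)
  ultimately show "(LINT r:shell \<Delta> (Suc (Suc j))|lborel. ?V r) \<le> (LINT r:shell \<Delta> (Suc j)|lborel. ?V r)"
    unfolding eq by simp
qed

text \<open>At the level exp (- \<Delta>) / \<pi> the bound is the vacuum's mass in the innermost
  disc. It is strict since part of the interior of each shell lies outside the ellipse, where
  \<open>W\<close> is below that level.\<close>

lemma shell_integral_less_vacuum:
  assumes a: "a > 0" and \<Delta>: "\<Delta> > 0" and ne: "\<not> (a = 1 \<and> s = 0 \<and> r0 = (0, 0))"
  shows "(LINT r:shell \<Delta> (Suc j)|lborel. gauss_wigner a s r0 r) <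
    (LINT r:shell \<Delta> (Suc 0)|lborel. gauss_wigner 1 0 (0, 0) r)"
proof -
  let ?U = "{r. real j * \<Delta> < (norm r)\<^sup>2} \<inter> {r. (norm r)\<^sup>2 < real (Suc j) * \<Delta>} \<inter>
    {r. \<Delta> < (norm (normal_form a s r0 r))\<^sup>2}"
  have "open ?U"
    by (intro open_Int open_Collect_less continuous_intros continuous_normal_form)
  moreover have "?U \<noteq> {}"
    using shell_not_subset_ellipse[OF a \<Delta> ne, of j] by blast
  moreover have "?U \<subseteq> shell \<Delta> (Suc j)"
    by (auto simp: shell_def)
  moreover have "gauss_wigner a s r0 r < exp (- \<Delta>) / pi" if "r \<in> ?U" for r
    using that by (simp add: gauss_wigner_normal_form[OF a] divide_strict_right_mono)
  ultimately have "(LINT r:shell \<Delta> (Suc j)|lborel. gauss_wigner a s r0 r) <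
      (LINT r|lborel. max 0 (gauss_wigner 1 0 (0, 0) r - exp (- \<Delta>) / pi)) + exp (- \<Delta>) / pi * (pi * \<Delta>)"
    using \<Delta> by (intro set_integral_less_excess[OF a \<Delta> _ emeasure_shell[OF \<Delta>]]) auto
  then show ?thesis
    using vacuum_disc_integral[OF \<Delta>, of 1] by simp
qed

lemma sum_shell_integrals_le_vacuum:
  assumes a: "a > 0" and \<Delta>: "\<Delta> > 0" and F: "finite F"
  shows "(\<Sum>j\<in>F. LINT r:shell \<Delta> (Suc j)|lborel. gauss_wigner a s r0 r) \<le>
    (\<Sum>j<card F. LINT r:shell \<Delta> (Suc j)|lborel. gauss_wigner 1 0 (0, 0) r)"
  unfolding sum_shell_integrals[OF a \<Delta> F] vacuum_disc_integral[OF \<Delta>]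
  using \<Delta> F
  by (intro set_integral_le_excess[OF a \<Delta> _ emeasure_Union_shells[OF \<Delta> F]]) auto

theorem mainTheorem6:
  fixes \<alpha> \<zeta> :: complex and \<Delta> :: real
  assumes "(\<alpha>, \<zeta>) \<noteq> (0, 0)" and "\<Delta> > 0"
  shows "shell_probs (displacement \<alpha> (squeezing \<zeta> vacuum)) \<Delta> \<preceq>\<^sub>m shell_probs vacuum \<Delta>
    \<and> \<not> shell_probs vacuum \<Delta> \<preceq>\<^sub>m shell_probs (displacement \<alpha> (squeezing \<zeta> vacuum)) \<Delta>"
proof -
  obtain a s q0 p0 where a: "a > 0"
    and W: "wigner (displacement \<alpha> (squeezing \<zeta> vacuum)) = gauss_wigner a s (q0, p0)"
    and ne: "\<not> (a = 1 \<and> s = 0 \<and> (q0, p0) = (0, 0))"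
    using wigner_gaussian_state[of \<alpha> \<zeta>] assms(1) by metis
  note \<Delta> = assms(2)
  let ?P = "\<lambda>j. LINT r:shell \<Delta> (Suc j)|lborel. gauss_wigner a s (q0, p0) r"
  let ?Q = "\<lambda>j. LINT r:shell \<Delta> (Suc j)|lborel. gauss_wigner 1 0 (0, 0) r"
  have P: "shell_probs (displacement \<alpha> (squeezing \<zeta> vacuum)) \<Delta> = ?P"
    and Q: "shell_probs vacuum \<Delta> = ?Q"
    by (simp_all add: shell_probs_def W wigner_vacuum)
  have pos: "?P j > 0" "?Q j > 0" for j
    using shell_integral_pos[OF a \<Delta>] shell_integral_pos[OF zero_less_one \<Delta>] by blast+
  note sums = shell_integrals_sums[OF a \<Delta>, of s "(q0, p0)"]
    shell_integrals_sums[OF zero_less_one \<Delta>, of 0 "(0, 0)"]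
  have "?P \<preceq>\<^sub>m ?Q"
    by (rule majorized_by_antimono[OF pos antimono_vacuum_shell_integrals[OF \<Delta>] sums
          sum_shell_integrals_le_vacuum[OF a \<Delta>]])
  \<comment> \<open>Every entry of \<open>?P\<close>, in particular its largest, is strictly below
    the first and largest entry of \<open>?Q\<close>.\<close>
  moreover have "\<not> ?Q \<preceq>\<^sub>m ?P"
    by (rule not_majorized_by_if_less[OF pos antimono_vacuum_shell_integrals[OF \<Delta>]
          sums_summable[OF sums(1)] shell_integral_less_vacuum[OF a \<Delta> ne]])
  ultimately show ?thesis
    unfolding P Q by blast
qed

end
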